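(* Let $\mathbb F\in\{\mathbb R,\mathbb C\}$ and let $A,B,C\in \mathbf{Gr}_{n,k}(\mathbb F)$ lie within a metric ball $\mathcal B\subset \mathbf{Gr}_{n,k}(\mathbb F)$ of radius less than $\rho_{\mathbb F}$. Then $$d(A\sharp B,\ A\sharp C)\ \ge\ \frac{d(B,C)}{2}.$$
   Context: For $\mathbb F=\mathbb C$, $\mathbf{Gr}_{n,k}(\mathbb C)=\{P\in\mathbb C^{n\times n}: P^2=P,\ P^*=P,\ \operatorname{rank}P=k\}$, a compact submanifold of the real vector space of $n\times n$ Hermitian matrices; for $\mathbb F=\mathbb R$, $\mathbf{Gr}_{n,k}(\mathbb R)=\{P\in\mathbb R^{n\times n}: P^2=P,\ P^\top=P,\ \operatorname{rank}P=k\}$, a compact submanifold of the space of real symmetric $n\times n$ matrices. It carries the Riemannian metric induced by the Frobenius inner product, $\langle X,Y\rangle_P=\operatorname{tr}(XY)$ for $X,Y\in T_P\mathbf{Gr}_{n,k}(\mathbb F)$. $d$ denotes the Riemannian distance and $\mathrm{Exp}_P$ the Riemannian exponential map at $P$. Let $R_P$ be the injectivity radius at $P$ (the largest $R>0$ such that $\mathrm{Exp}_P$ is a diffeomorphism from the open ball of radius $R$ about $0$ in $T_P\mathbf{Gr}_{n,k}(\mathbb F)$ onto its image), $r_{\mathbb F}=\min_P R_P>0$, and let $\delta_{\mathbb F}$ be the maximum of the sectional curvatures of $\mathbf{Gr}_{n,k}(\mathbb F)$. Put $$\rho_{\mathbb F}=\min\left\{\frac{r_{\mathbb F}}{2},\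 \frac{\pi}{2\,\delta_{\mathbb F}^{1/2}}\right\}.$$ Convention: the second term is $+\infty$ if the manifold has no tangent 2-planes (dimension at most 1), and $R_P=+\infty$ if the manifold is a single point. It is known that every metric ball $\mathcal B$ of radius less than $\rho_{\mathbb F}$ is strongly convex: for any $P,Q\in\mathcal B$ there is a unique minimizing geodesic from $P$ to $Q$ in $\mathbf{Gr}_{n,k}(\mathbb F)$, and it lies entirely in $\mathcal B$. For $P,Q\in\mathcal B$, $\overrightarrow{PQ}=\mathrm{Exp}_P^{-1}Q\in T_P\mathbf{Gr}_{n,k}(\mathbb F)$ denotes the initial tangent vector of this geodesic (the unique vector of norm less than $r_{\mathbb F}$ with $\mathrm{Exp}_P(\overrightarrow{PQ})=Q$). The geometric mean is $P\sharp Q=\mathrm{Exp}_P(\tfrac12\,\overrightarrow{PQ})$, the midpoint of the geodesic from $P$ to $Q$. *)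

theory Defs
  imports "HOL-Analysis.Analysis"
begin

text \<open>
  Riemannian notions are defined for a subset \<open>M\<close> of a Euclidean space, meant to be a compact
  embedded smooth submanifold with the metric induced by the ambient inner product.
\<close>

subsection \<open>Smooth maps\<close>

primrec Ck_on :: "nat \<Rightarrow> 'a::euclidean_space set \<Rightarrow> ('a \<Rightarrow> 'b::euclidean_space) \<Rightarrow> bool" where
  "Ck_on 0 U f \<longleftrightarrow> continuous_on U f"
| "Ck_on (Suc m) U f \<longleftrightarrow>
     (\<forall>x\<in>U. f differentiable (at x)) \<and> (\<forall>v. Ck_on m U (\<lambda>x. frechet_derivative f (at x) v))"

text \<open>Smoothness on an arbitrary subset of a Euclidean space: existence of local smooth extensions.\<close>

definition smooth_on :: "'a::euclidean_space set \<Rightarrow> ('a \<Rightarrow> 'b::euclidean_space) \<Rightarrow> bool" where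
  "smooth_on S f \<longleftrightarrow>
     (\<forall>x\<in>S. \<exists>U F. open U \<and> x \<in> U \<and> (\<forall>m. Ck_on m U F) \<and> (\<forall>y\<in>U \<inter> S. F y = f y))"

definition diffeo_onto_image :: "'a::euclidean_space set \<Rightarrow> ('a \<Rightarrow> 'b::euclidean_space) \<Rightarrow> bool" where
  "diffeo_onto_image S f \<longleftrightarrow> smooth_on S f \<and> inj_on f S \<and> smooth_on (f ` S) (inv_into S f)"

subsection \<open>Tangent spaces and the Levi-Civita connection\<close>

definition smooth_curve_through ::
    "'a::euclidean_space set \<Rightarrow> 'a \<Rightarrow> 'a \<Rightarrow> (real \<Rightarrow> 'a) \<Rightarrow> bool" where
  "smooth_curve_through M p v \<gamma> \<longleftrightarrow>
     (\<exists>\<epsilon>>0. smooth_on {-\<epsilon><..<\<epsilon>} \<gamma> \<and> \<gamma> ` {-\<epsilon><..<\<epsilon>} \<subseteq> M) \<and>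
     \<gamma> 0 = p \<and> (\<gamma> has_vector_derivative v) (at 0)"

definition tangent_space :: "'a::euclidean_space set \<Rightarrow> 'a \<Rightarrow> 'a set" where
  "tangent_space M p = {v. \<exists>\<gamma>. smooth_curve_through M p v \<gamma>}"

definition tangential_proj :: "'a::euclidean_space set \<Rightarrow> 'a \<Rightarrow> 'a \<Rightarrow> 'a" where
  "tangential_proj M p x =
     (THE y. y \<in> tangent_space M p \<and> (\<forall>z\<in>tangent_space M p. inner (x - y) z = 0))"

definition smooth_vector_field :: "'a::euclidean_space set \<Rightarrow> ('a \<Rightarrow> 'a) \<Rightarrow> bool" where
  "smooth_vector_field M X \<longleftrightarrow> smooth_on M X \<and> (\<forall>p\<in>M. X p \<in> tangent_space M p)"

definition dir_deriv ::
    "'a::euclidean_space set \<Rightarrow> ('a \<Rightarrow> 'b::euclidean_space) \<Rightarrow> 'a \<Rightarrow> 'a \<Rightarrow> 'b" where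
  "dir_deriv M f p v =
     (THE w. \<exists>\<gamma>. smooth_curve_through M p v \<gamma> \<and> ((f \<circ> \<gamma>) has_vector_derivative w) (at 0))"

text \<open>
  The Levi-Civita connection of the induced metric: the tangential part of the ambient derivative.
  The same projection gives the covariant derivative along curves used for geodesics below.
\<close>

definition levi_civita :: "'a::euclidean_space set \<Rightarrow> ('a \<Rightarrow> 'a) \<Rightarrow> ('a \<Rightarrow> 'a) \<Rightarrow> 'a \<Rightarrow> 'a" where
  "levi_civita M X Y p = tangential_proj M p (dir_deriv M Y p (X p))"

definition lie_bracket :: "'a::euclidean_space set \<Rightarrow> ('a \<Rightarrow> 'a) \<Rightarrow> ('a \<Rightarrow> 'a) \<Rightarrow> 'a \<Rightarrow> 'a" where
  "lie_bracket M X Y p = dir_deriv M Y p (X p) - dir_deriv M X p (Y p)"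

definition riem_curvature ::
    "'a::euclidean_space set \<Rightarrow> ('a \<Rightarrow> 'a) \<Rightarrow> ('a \<Rightarrow> 'a) \<Rightarrow> ('a \<Rightarrow> 'a) \<Rightarrow> 'a \<Rightarrow> 'a" where
  "riem_curvature M X Y Z p =
     levi_civita M X (levi_civita M Y Z) p - levi_civita M Y (levi_civita M X Z) p
     - levi_civita M (lie_bracket M X Y) Z p"

text \<open>
  The sectional curvature of the plane spanned by \<open>X p\<close> and \<open>Y p\<close> depends only on that plane, and
  every pair of tangent vectors extends to smooth vector fields, so the set below consists of the
  sectional curvatures of all tangent 2-planes. The denominator vanishes exactly if \<open>X p\<close> and \<open>Y p\<close>
  are linearly dependent.
\<close>

definition sectional_curvatures :: "'a::euclidean_space set \<Rightarrow> real set" where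
  "sectional_curvatures M =
     {inner (riem_curvature M X Y Y p) (X p)
        / ((norm (X p))\<^sup>2 * (norm (Y p))\<^sup>2 - (inner (X p) (Y p))\<^sup>2) | X Y p.
      smooth_vector_field M X \<and> smooth_vector_field M Y \<and> p \<in> M \<and>
      (norm (X p))\<^sup>2 * (norm (Y p))\<^sup>2 - (inner (X p) (Y p))\<^sup>2 \<noteq> 0}"

subsection \<open>Distance, geodesics and the exponential map\<close>

text \<open>
  The predicate \<open>valid_path\<close> does not require one-sided limits of the derivative at the exceptional
  points, so the speed need not be integrable; \<open>has_integral\<close> restricts to paths of finite length.
\<close>

definition path_lengths :: "'a::euclidean_space set \<Rightarrow> 'a \<Rightarrow> 'a \<Rightarrow> real set" where
  "path_lengths M p q =
     {L. \<exists>\<gamma>. valid_path \<gamma> \<and> path_image \<gamma> \<subseteq> M \<and> pathstart \<gamma> = p \<and> pathfinish \<gamma> = q \<and>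
          ((\<lambda>t. norm (vector_derivative \<gamma> (at t))) has_integral L) {0..1}}"

definition riem_dist :: "'a::euclidean_space set \<Rightarrow> 'a \<Rightarrow> 'a \<Rightarrow> real" where
  "riem_dist M p q = Inf (path_lengths M p q)"

definition riem_ball :: "'a::euclidean_space set \<Rightarrow> 'a \<Rightarrow> real \<Rightarrow> 'a set" where
  "riem_ball M p r = {q\<in>M. riem_dist M p q < r}"

text \<open>Geodesics are defined on the whole line, as compact manifolds are complete.\<close>

definition geodesic :: "'a::euclidean_space set \<Rightarrow> (real \<Rightarrow> 'a) \<Rightarrow> bool" where
  "geodesic M \<gamma> \<longleftrightarrow> smooth_on UNIV \<gamma> \<and> range \<gamma> \<subseteq> M \<and>
     (\<forall>t. tangential_proj M (\<gamma> t)
            (vector_derivative (\<lambda>s. vector_derivative \<gamma> (at s)) (at t)) = 0)"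

definition riem_exp :: "'a::euclidean_space set \<Rightarrow> 'a \<Rightarrow> 'a \<Rightarrow> 'a" where
  "riem_exp M p v =
     (THE q. \<exists>\<gamma>. geodesic M \<gamma> \<and> \<gamma> 0 = p \<and> (\<gamma> has_vector_derivative v) (at 0) \<and> \<gamma> 1 = q)"

text \<open>For a single point the supremum is \<open>\<infinity>\<close>.\<close>

definition inj_radius_at :: "'a::euclidean_space set \<Rightarrow> 'a \<Rightarrow> ereal" where
  "inj_radius_at M p =
     Sup {ereal R | R. R > 0 \<and>
            diffeo_onto_image {v \<in> tangent_space M p. norm v < R} (riem_exp M p)}"

definition inj_radius :: "'a::euclidean_space set \<Rightarrow> ereal" where
  "inj_radius M = (INF p\<in>M. inj_radius_at M p)"

definition max_sectional_curvature :: "'a::euclidean_space set \<Rightarrow> real" where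
  "max_sectional_curvature M = Sup (sectional_curvatures M)"

definition rho :: "'a::euclidean_space set \<Rightarrow> ereal" where
  "rho M = min (inj_radius M / 2)
     (if sectional_curvatures M = {} then \<infinity>
      else ereal pi / (2 * ereal (sqrt (max_sectional_curvature M))))"

definition riem_log :: "'a::euclidean_space set \<Rightarrow> 'a \<Rightarrow> 'a \<Rightarrow> 'a" where
  "riem_log M p q =
     (THE v. v \<in> tangent_space M p \<and> ereal (norm v) < inj_radius M \<and> riem_exp M p v = q)"

definition geom_mean :: "'a::euclidean_space set \<Rightarrow> 'a \<Rightarrow> 'a \<Rightarrow> 'a" where
  "geom_mean M p q = riem_exp M p ((1/2) *\<^sub>R riem_log M p q)"

subsection \<open>Grassmannians\<close>

definition conj_transpose :: "complex^'n^'n \<Rightarrow> complex^'n^'n" where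
  "conj_transpose P = map_matrix cnj (transpose P)"

definition Gr_real :: "nat \<Rightarrow> (real^'n^'n) set" where
  "Gr_real k = {P. P ** P = P \<and> transpose P = P \<and> rank P = k}"

definition Gr_complex :: "nat \<Rightarrow> (complex^'n^'n) set" where
  "Gr_complex k = {P. P ** P = P \<and> conj_transpose P = P \<and> rank P = k}"

text \<open>The ambient inner product is the Frobenius inner product.\<close>

lemma inner_eq_trace_real:
  fixes X Y :: "real^'n^'n"
  assumes "transpose Y = Y"
  shows "inner X Y = trace (X ** Y)"
proof -
  have Y: "Y $ i $ j = Y $ j $ i" for i j
    using assms by (metis transpose_def vec_lambda_beta)
  have "inner X Y = (\<Sum>i\<in>UNIV. \<Sum>j\<in>UNIV. X $ i $ j * Y $ i $ j)"
    by (simp add: inner_vec_def)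
  also have "\<dots> = (\<Sum>i\<in>UNIV. \<Sum>j\<in>UNIV. X $ i $ j * Y $ j $ i)"
    by (intro sum.cong refl arg_cong2[where f = "(*)"] Y)
  finally show ?thesis by (simp add: trace_def matrix_matrix_mult_def)
qed

lemma inner_eq_trace_complex:
  fixes X Y :: "complex^'n^'n"
  assumes X: "conj_transpose X = X" and Y: "conj_transpose Y = Y"
  shows "complex_of_real (inner X Y) = trace (X ** Y)"
proof -
  have "conj_transpose Z $ j $ i = cnj (Z $ i $ j)" for Z :: "complex^'n^'n" and i j
    by (simp add: conj_transpose_def transpose_def)
  then have x: "cnj (X $ i $ j) = X $ j $ i" and y: "cnj (Y $ i $ j) = Y $ j $ i" for i j
    using X Y by metis+
  have "inner (X $ i $ j) (Y $ i $ j) = Re (X $ i $ j * Y $ j $ i)" for i j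
    unfolding y[of i j, symmetric] by (simp add: inner_complex_def)
  then have re: "Re (trace (X ** Y)) = inner X Y"
    by (simp add: trace_def matrix_matrix_mult_def inner_vec_def)
  have "cnj (trace (X ** Y)) = (\<Sum>i\<in>UNIV. \<Sum>j\<in>UNIV. X $ j $ i * Y $ i $ j)"
    by (simp add: trace_def matrix_matrix_mult_def x y)
  also have "\<dots> = trace (X ** Y)"
    by (subst sum.swap) (simp add: trace_def matrix_matrix_mult_def)
  finally have "Im (trace (X ** Y)) = 0"
    by (metis Reals_cnj_iff complex_is_Real_iff)
  with re show ?thesis by (simp add: complex_eq_iff)
qed

end

theory Submission
  imports Defs
begin

text \<open>
  Write a projection as \<open>P = (1 + S) / 2\<close> with a self-adjoint reflection \<open>S\<close>. Along a geodesic the skew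
  element \<open>S S'\<close> is constant, so the geodesic from \<open>S\<close> with velocity \<open>v\<close> is \<open>S exp (t K)\<close>, where
  \<open>K = 2 S v\<close>. Hence \<open>X\<close> is recovered from its midpoint \<open>Q\<close> with \<open>A\<close> by the globally defined doubling
  map \<open>S\<^sub>Q \<mapsto> S\<^sub>Q S\<^sub>A S\<^sub>Q\<close>. Multiplication by a reflection is an isometry, so this map at most doubles the
  length of every path in the Grassmannian; applied to paths from the mean of \<open>A\<close> and \<open>B\<close> to the mean
  of \<open>A\<close> and \<open>C\<close>, this is the claim.

  It remains to see that the logarithm at \<open>A\<close> is defined on the ball, that is, that a path of length
  below the injectivity radius can be lifted through the exponential map without the norm of the lift
  outgrowing the length. By the Gauss lemma the norm of a lift grows at most with the speed of the path,
  and lifts can be continued because the exponential map is open by invariance of domain.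

  Since the infimum of the empty set of reals is unspecified, statements about \<open>riem_dist\<close> also require
  that the Grassmannian is connected by paths of finite length.
\<close>

text \<open>A path between the two means is arbitrary and may leave the ball, where no logarithm at
  \<open>A\<close> is at hand. This is why midpoints are undone by a map defined on all of
  \<open>M\<close> rather than by doubling vectors in normal coordinates. The constant 2 of the
  theorem counts the occurrences of \<open>S\<^sub>Q\<close> in
  \<open>S\<^sub>Q S\<^sub>A S\<^sub>Q\<close>: the product rule gives two terms, each as long as
  the velocity of \<open>Q\<close>.

  Logarithms are taken at \<open>A\<close>, which need not be the centre of the ball, and the route
  from \<open>A\<close> to \<open>B\<close> runs through the centre. Hence lengths up to
  \<open>2 r\<close> have to stay below the injectivity radius.

  The real and complex cases share one argument: the transpose of a multiplication operator for the
  Frobenius inner product is multiplication by the adjoint. In this algebra tangent vectors at a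
  projection anticommute with its reflection, self-adjoint normal vectors commute with it, and the
  geodesic equation becomes a linear equation with constant coefficient.\<close>

locale star_algebra =
  fixes mul :: "'e::euclidean_space \<Rightarrow> 'e \<Rightarrow> 'e" (infixl \<open>\<odot>\<close> 70)
    and one :: 'e (\<open>\<one>\<close>)
    and adj :: "'e \<Rightarrow> 'e"
  assumes bilinear_mul: "bounded_bilinear (\<odot>)"
    and mul_assoc: "x \<odot> y \<odot> z = x \<odot> (y \<odot> z)"
    and one_mul [simp]: "\<one> \<odot> x = x"
    and mul_one [simp]: "x \<odot> \<one> = x"
    and linear_adj: "bounded_linear adj"
    and adj_mul: "adj (x \<odot> y) = adj y \<odot> adj x"
    and adj_adj [simp]: "adj (adj x) = x"
    and inner_mul_left: "inner (x \<odot> y) z = inner y (adj x \<odot> z)"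
    and inner_mul_right: "inner (x \<odot> y) z = inner x (z \<odot> adj y)"
begin

section \<open>Star algebras: unitary and skew elements\<close>

sublocale mul: bounded_bilinear "(\<odot>)"
  by (rule bilinear_mul)

sublocale adj: bounded_linear adj
  by (rule linear_adj)

lemmas mul_simps = mul.add_left mul.add_right mul.diff_left mul.diff_right
  mul.scaleR_left mul.scaleR_right mul.minus_left mul.minus_right mul_assoc

lemma adj_one [simp]: "adj \<one> = \<one>"
  by (metis adj_adj adj_mul mul_one)

definition skew :: "'e \<Rightarrow> bool" where
  "skew x \<longleftrightarrow> adj x = - x"

definition unitary :: "'e \<Rightarrow> bool" where
  "unitary u \<longleftrightarrow> adj u \<odot> u = \<one> \<and> u \<odot> adj u = \<one>"

lemma unitary_mul: "unitary u \<Longrightarrow> unitary v \<Longrightarrow> unitary (u \<odot> v)"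
  by (auto simp: unitary_def adj_mul mul_assoc) (metis mul_assoc one_mul)+

lemma unitary_cancel:
  assumes "unitary u"
  shows "adj u \<odot> (u \<odot> x) = x" "u \<odot> (adj u \<odot> x) = x"
  using assms by (simp_all add: unitary_def flip: mul_assoc)

lemma norm_unitary_mul:
  assumes "unitary u"
  shows "norm (u \<odot> x) = norm x"
  by (simp add: norm_eq_sqrt_inner inner_mul_left unitary_cancel[OF assms])

lemma norm_mul_unitary:
  assumes "unitary u"
  shows "norm (x \<odot> u) = norm x"
  using assms by (simp add: norm_eq_sqrt_inner inner_mul_right mul_assoc unitary_def)

text \<open>Right multiplication by a skew element is antisymmetric for the inner product, so
  solutions of \<open>f' = f \<odot> k\<close> have constant norm. This is the source of uniqueness
  in \<open>skew_ode_unique\<close>.\<close>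

lemma inner_skew_zero:
  assumes "skew k"
  shows "inner (x \<odot> k) x = 0"
proof -
  have "inner (x \<odot> k) x = inner x (x \<odot> (- k))"
    using assms by (simp add: inner_mul_right skew_def)
  then show ?thesis
    by (simp add: mul.minus_right inner_commute)
qed

subsection \<open>One-parameter groups\<close>

text \<open>Coefficients of the series of exp (t k); the power of \<open>k\<close> is an iterate of
  right multiplication because \<open>\<odot>\<close> is a locale parameter.\<close>

definition flow_coeff :: "'e \<Rightarrow> nat \<Rightarrow> 'e" where
  "flow_coeff k n = inverse (fact n) *\<^sub>R ((\<lambda>x. x \<odot> k) ^^ n) \<one>"

definition flow :: "'e \<Rightarrow> real \<Rightarrow> 'e" where
  "flow k t = (\<Sum>n. t ^ n *\<^sub>R flow_coeff k n)"

lemma flow_coeff_Suc: "real (Suc n) *\<^sub>R flow_coeff k (Suc n) = flow_coeff k n \<odot> k"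
  by (simp add: flow_coeff_def mul.scaleR_left field_simps del: of_nat_Suc)

lemma summable_flow: "summable (\<lambda>n. t ^ n *\<^sub>R flow_coeff k n)"
proof -
  obtain C where C: "C > 0" "\<And>x y. norm (x \<odot> y) \<le> norm x * norm y * C"
    using mul.pos_bounded by blast
  define b where "b = norm k * C"
  have b: "b \<ge> 0"
    using C by (simp add: b_def)
  have pow: "norm (((\<lambda>x. x \<odot> k) ^^ n) \<one>) \<le> b ^ n * norm \<one>" for n
  proof (induction n)
    case (Suc n)
    have "norm (((\<lambda>x. x \<odot> k) ^^ Suc n) \<one>) \<le> norm (((\<lambda>x. x \<odot> k) ^^ n) \<one>) * b"
      using C(2)[of "((\<lambda>x. x \<odot> k) ^^ n) \<one>" k] by (simp add: b_def mult.assoc)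
    also have "\<dots> \<le> b ^ n * norm \<one> * b"
      using Suc b by (rule mult_right_mono)
    finally show ?case
      by (simp add: algebra_simps)
  qed simp
  show ?thesis
  proof (rule summable_comparison_test')
    show "summable (\<lambda>n. (\<bar>t\<bar> * b) ^ n /\<^sub>R fact n * norm \<one>)"
      by (intro summable_mult2 summable_exp_generic)
    fix n
    have "norm (t ^ n *\<^sub>R flow_coeff k n)
        = \<bar>t\<bar> ^ n * inverse (fact n) * norm (((\<lambda>x. x \<odot> k) ^^ n) \<one>)"
      by (simp add: flow_coeff_def power_abs abs_mult)
    also have "\<dots> \<le> \<bar>t\<bar> ^ n * inverse (fact n) * (b ^ n * norm \<one>)"
      by (intro mult_left_mono pow) auto
    finally show "norm (t ^ n *\<^sub>R flow_coeff k n) \<le> (\<bar>t\<bar> * b) ^ n /\<^sub>R fact n * norm \<one>"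
      by (simp add: power_mult_distrib algebra_simps)
  qed
qed

lemma flow_zero [simp]: "flow k 0 = \<one>"
proof -
  have "flow k 0 = (\<Sum>n\<in>{0}. 0 ^ n *\<^sub>R flow_coeff k n)"
    unfolding flow_def by (intro suminf_finite) auto
  then show ?thesis
    by (simp add: flow_coeff_def)
qed

text \<open>Each coordinate of the series is a real power series in \<open>t\<close>, to which
  termwise differentiation applies.\<close>

lemma flow_has_vector_derivative: "(flow k has_vector_derivative flow k t \<odot> k) (at t)"
  unfolding has_vector_derivative_def
proof (subst has_derivative_componentwise_within, intro ballI)
  fix b :: 'e
  assume "b \<in> Basis"
  define c where "c n = inner (flow_coeff k n) b" for n
  have inner_flow: "inner (flow k s) b = (\<Sum>n. c n * s ^ n)" for s
    unfolding flow_def c_def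
    by (subst bounded_linear.suminf[OF bounded_linear_inner_left summable_flow]) (simp add: mult.commute)
  have summable_c: "summable (\<lambda>n. c n * s ^ n)" for s
    using bounded_linear.summable[OF bounded_linear_inner_left summable_flow, of s k b]
    by (simp add: c_def mult.commute)
  have diffs: "diffs c n = inner (flow_coeff k n \<odot> k) b" for n
    by (simp add: diffs_def c_def flip: flow_coeff_Suc)
  have bl: "bounded_linear (\<lambda>x. inner (x \<odot> k) b)"
    by (intro bounded_linear_compose[OF bounded_linear_inner_left mul.bounded_linear_left])
  have "inner (flow k t \<odot> k) b = (\<Sum>n. diffs c n * t ^ n)"
    unfolding flow_def diffs
    by (subst bounded_linear.suminf[OF bl summable_flow]) (simp add: mul.scaleR_left mult.commute)
  then have "((\<lambda>s. inner (flow k s) b) has_field_derivative inner (flow k t \<odot> k) b) (at t)"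
    using termdiffs_strong_converges_everywhere[OF summable_c, of t]
    by (simp add: inner_flow[abs_def])
  then show "((\<lambda>s. inner (flow k s) b) has_derivative (\<lambda>s. inner (s *\<^sub>R (flow k t \<odot> k)) b)) (at t)"
    by (simp add: has_field_derivative_def mult.commute[of _ "inner (flow k t \<odot> k) b"])
qed

text \<open>The difference of two solutions is again a solution, has constant norm and starts at 0.
  The functional equations of \<open>flow\<close> below are all proved by exhibiting both sides as
  solutions of one such equation.\<close>

lemma skew_ode_unique:
  assumes "skew k"
    and "\<And>t. (f has_vector_derivative f t \<odot> k) (at t)"
    and "\<And>t. (g has_vector_derivative g t \<odot> k) (at t)"
    and "f 0 = g 0"
  shows "f t = g t"
proof -
  have "((\<lambda>t. inner (f t - g t) (f t - g t)) has_vector_derivative 0) (at t within UNIV)" for t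
  proof -
    have "((\<lambda>t. f t - g t) has_vector_derivative (f t - g t) \<odot> k) (at t)"
      using has_vector_derivative_diff[OF assms(2) assms(3)] by (simp add: mul.diff_left)
    from bounded_bilinear.has_vector_derivative[OF bounded_bilinear_inner this this]
    show ?thesis
      using inner_skew_zero[OF assms(1), of "f t - g t"] by (simp add: inner_commute)
  qed
  then obtain c where "inner (f t - g t) (f t - g t) = c" for t
    using has_vector_derivative_zero_constant[of UNIV "\<lambda>t. inner (f t - g t) (f t - g t)"] by auto
  from this[of t] this[of 0] assms(4) show ?thesis
    by simp
qed

lemma has_vector_derivative_mul_const:
  "(f has_vector_derivative f') (at t) \<Longrightarrow> ((\<lambda>t. a \<odot> f t \<odot> b) has_vector_derivative a \<odot> f' \<odot> b) (at t)"
  by (intro bounded_linear.has_vector_derivative[OF mul.bounded_linear_left]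
      bounded_linear.has_vector_derivative[OF mul.bounded_linear_right])

lemma flow_comm:
  assumes "skew k"
  shows "k \<odot> flow k t = flow k t \<odot> k"
proof (rule skew_ode_unique[OF assms])
  show "((\<lambda>t. k \<odot> flow k t) has_vector_derivative k \<odot> flow k t \<odot> k) (at t)" for t
    using has_vector_derivative_mul_const[OF flow_has_vector_derivative, of k k \<one> t]
    by (simp add: mul_assoc)
  show "((\<lambda>t. flow k t \<odot> k) has_vector_derivative flow k t \<odot> k \<odot> k) (at t)" for t
    using has_vector_derivative_mul_const[OF flow_has_vector_derivative, of \<one> k k t] by simp
qed simp

lemma flow_add:
  assumes "skew k"
  shows "flow k (s + t) = flow k s \<odot> flow k t"
proof (rule skew_ode_unique[OF assms, of "\<lambda>t. flow k (s + t)"])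
  have shift: "((\<lambda>t. s + t) has_vector_derivative 1) (at t)" for t
    by (auto intro!: derivative_eq_intros)
  show "((\<lambda>t. flow k (s + t)) has_vector_derivative flow k (s + t) \<odot> k) (at t)" for t
    using vector_diff_chain_at[of "\<lambda>t. s + t" 1 t "flow k", OF shift flow_has_vector_derivative]
    by (simp add: o_def)
  show "((\<lambda>t. flow k s \<odot> flow k t) has_vector_derivative flow k s \<odot> flow k t \<odot> k) (at t)" for t
    using has_vector_derivative_mul_const[OF flow_has_vector_derivative, of "flow k s" k \<one> t]
    by (simp add: mul_assoc)
qed simp

lemma flow_scaleR:
  assumes "skew k"
  shows "flow (c *\<^sub>R k) t = flow k (c * t)"
proof (rule skew_ode_unique[OF _ flow_has_vector_derivative])
  have scale: "((\<lambda>t. c * t) has_vector_derivative c) (at t)" for t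
    using DERIV_cmult_Id[of c t UNIV] by (simp add: has_real_derivative_iff_has_vector_derivative)
  show "skew (c *\<^sub>R k)"
    using assms by (simp add: skew_def adj.scaleR)
  show "((\<lambda>t. flow k (c * t)) has_vector_derivative flow k (c * t) \<odot> c *\<^sub>R k) (at t)" for t
    using vector_diff_chain_at[of "\<lambda>t. c * t" c t "flow k", OF scale flow_has_vector_derivative]
    by (simp add: o_def mul.scaleR_right)
qed simp

lemma flow_minus: "skew k \<Longrightarrow> flow (- k) t = flow k (- t)"
  using flow_scaleR[of k "-1" t] by simp

lemma unitary_conj_flow:
  assumes "skew k" "unitary u"
  shows "u \<odot> flow k t \<odot> adj u = flow (u \<odot> k \<odot> adj u) t"
proof (rule skew_ode_unique[of "u \<odot> k \<odot> adj u", OF _ _ flow_has_vector_derivative])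
  show "skew (u \<odot> k \<odot> adj u)"
    using assms by (simp add: skew_def adj_mul mul_simps)
  show "((\<lambda>t. u \<odot> flow k t \<odot> adj u) has_vector_derivative u \<odot> flow k t \<odot> adj u \<odot> (u \<odot> k \<odot> adj u)) (at t)" for t
    using has_vector_derivative_mul_const[OF flow_has_vector_derivative, of u k "adj u" t] assms(2)
    by (simp add: mul_assoc unitary_cancel)
  show "u \<odot> flow k 0 \<odot> adj u = flow (u \<odot> k \<odot> adj u) 0"
    using assms(2) by (simp add: unitary_def)
qed

lemma adj_flow:
  assumes "skew k"
  shows "adj (flow k t) = flow k (- t)"
proof -
  have "adj (flow k t) = flow (- k) t"
  proof (rule skew_ode_unique[of "- k", OF _ _ flow_has_vector_derivative])
    show "skew (- k)"
      using assms by (simp add: skew_def adj.neg)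
    show "((\<lambda>t. adj (flow k t)) has_vector_derivative adj (flow k t) \<odot> - k) (at t)" for t
      using bounded_linear.has_vector_derivative[OF linear_adj flow_has_vector_derivative, of k t]
        arg_cong[OF flow_comm[OF assms, of t], of adj] assms
      by (simp add: adj_mul skew_def mul.minus_left mul.minus_right)
  qed simp
  then show ?thesis
    by (simp add: flow_minus assms)
qed

lemma unitary_flow: "skew k \<Longrightarrow> unitary (flow k t)"
  by (simp add: unitary_def adj_flow flip: flow_add)

end

section \<open>Smooth maps and their derivatives\<close>

lemma smooth_onI:
  assumes "\<And>m. Ck_on m UNIV f"
  shows "smooth_on S f"
  unfolding smooth_on_def using assms by (intro ballI exI[of _ UNIV] exI[of _ f]) auto

lemma smooth_onE:
  assumes "smooth_on S f" "x \<in> S"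
  obtains U F where "open U" "x \<in> U" "\<forall>m. Ck_on m U F" "\<forall>y\<in>U \<inter> S. F y = f y"
proof -
  from assms have "\<exists>U F. open U \<and> x \<in> U \<and> (\<forall>m. Ck_on m U F) \<and> (\<forall>y\<in>U \<inter> S. F y = f y)"
    unfolding smooth_on_def by (rule bspec)
  then show ?thesis
    by (elim exE conjE) (rule that)
qed

lemma Ck_on_0_of_differentiable:
  "(\<And>x. x \<in> U \<Longrightarrow> f differentiable (at x)) \<Longrightarrow> continuous_on U f"
  by (intro continuous_at_imp_continuous_on ballI differentiable_imp_continuous_within)

lemma smooth_on_imp_continuous_on:
  assumes "smooth_on S f"
  shows "continuous_on S f"
  unfolding continuous_on_eq_continuous_within
proof
  fix x
  assume "x \<in> S"
  with assms obtain U F where U: "open U" "x \<in> U" "\<forall>m. Ck_on m U F" "\<forall>y\<in>U \<inter> S. F y = f y"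
    by (rule smooth_onE)
  have "continuous (at x within S) F"
    using U(1,2) U(3)[rule_format, of 0] by (simp add: continuous_on_eq_continuous_at continuous_at_imp_continuous_at_within)
  then show "continuous (at x within S) f"
    by (rule continuous_transform_within_openin[where S = "S \<inter> U"])
      (use U(1,2,4) \<open>x \<in> S\<close> in \<open>auto simp: openin_open_Int\<close>)
qed

text \<open>On \<open>UNIV\<close> the local extension coincides with the curve near
  \<open>t\<close>, so its derivatives are those of the curve. Two orders are what the geodesic
  equation involves.\<close>

lemma smooth_on_UNIV_vector_derivatives:
  fixes f :: "real \<Rightarrow> 'e::euclidean_space"
  assumes "smooth_on UNIV f"
  shows "(f has_vector_derivative vector_derivative f (at t)) (at t)"
    and "((\<lambda>s. vector_derivative f (at s)) has_vector_derivative
           vector_derivative (\<lambda>s. vector_derivative f (at s)) (at t)) (at t)"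
proof -
  obtain U F where U: "open U" "t \<in> U" "\<forall>m. Ck_on m U F" "\<forall>y\<in>U \<inter> UNIV. F y = f y"
    using assms UNIV_I by (rule smooth_onE)
  have C2: "Ck_on (Suc (Suc 0)) U F"
    using U(3) by (rule spec)
  have F: "(f has_vector_derivative frechet_derivative F (at y) 1) (at y)" if "y \<in> U" for y
  proof -
    have "F differentiable (at y)"
      using C2 that by simp
    then have D: "(F has_derivative frechet_derivative F (at y)) (at y)"
      by (simp add: frechet_derivative_works)
    have "frechet_derivative F (at y) h = h *\<^sub>R frechet_derivative F (at y) 1" for h
      using linear_scale[OF has_derivative_linear[OF D], of h 1] by simp
    then have "(F has_vector_derivative frechet_derivative F (at y) 1) (at y)"
      unfolding has_vector_derivative_def by (intro has_derivative_eq_rhs[OF D] ext)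
    then show ?thesis
      using U(1) that by (rule has_vector_derivative_transform_within_open) (simp add: U(4))
  qed
  then have eq: "vector_derivative f (at y) = frechet_derivative F (at y) 1" if "y \<in> U" for y
    using that by (simp add: vector_derivative_at)
  show "(f has_vector_derivative vector_derivative f (at t)) (at t)"
    using F[OF U(2)] by (simp add: eq U(2))
  have "(\<lambda>y. frechet_derivative F (at y) 1) differentiable (at t)"
    using U(2) C2 by simp
  then have "((\<lambda>y. frechet_derivative F (at y) 1) has_vector_derivative
      vector_derivative (\<lambda>y. frechet_derivative F (at y) 1) (at t)) (at t)"
    by (simp add: vector_derivative_works)
  then have "((\<lambda>s. vector_derivative f (at s)) has_vector_derivative
      vector_derivative (\<lambda>y. frechet_derivative F (at y) 1) (at t)) (at t)"
    using U(1,2) eq[symmetric] by (rule has_vector_derivative_transform_within_open)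
  then show "((\<lambda>s. vector_derivative f (at s)) has_vector_derivative
           vector_derivative (\<lambda>s. vector_derivative f (at s)) (at t)) (at t)"
    by (simp add: vector_derivative_at)
qed

lemma has_vector_derivative_imp_continuous_on:
  assumes "\<And>t. (f has_vector_derivative f' t) (at t)"
  shows "continuous_on S f"
  by (intro continuous_at_imp_continuous_on ballI has_vector_derivative_continuous[OF assms])

context star_algebra
begin

text \<open>The shape \<open>c + x \<odot> flow k t\<close> is closed under differentiation:
  \<open>c\<close> becomes 0 and \<open>x\<close> a multiple of \<open>x \<odot> k\<close>. This is
  why the induction generalises over both.\<close>

lemma Ck_on_flow:
  assumes "skew k"
  shows "Ck_on m U (\<lambda>t. c + x \<odot> flow k t)"
proof -
  have vd: "((\<lambda>t. c + x \<odot> flow k t) has_vector_derivative x \<odot> k \<odot> flow k t) (at t)" for c x t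
    using has_vector_derivative_mul_const[OF flow_has_vector_derivative, of x k \<one> t] flow_comm[OF assms, of t]
    by (simp add: has_vector_derivative_add_const mul_assoc add.commute[of c])
  show ?thesis
  proof (induction m arbitrary: c x)
    case 0
    then show ?case
      using vd by (auto intro!: Ck_on_0_of_differentiable differentiableI_vector)
  next
    case (Suc m)
    have deriv: "((\<lambda>t. c + x \<odot> flow k t) has_derivative (\<lambda>v. v *\<^sub>R (x \<odot> k \<odot> flow k t))) (at t)" for t
      using vd by (simp add: has_vector_derivative_def)
    then have "frechet_derivative (\<lambda>t. c + x \<odot> flow k t) (at t) v = 0 + (v *\<^sub>R (x \<odot> k)) \<odot> flow k t" for t v
      by (subst frechet_derivative_at[OF deriv, symmetric]) (simp add: mul.scaleR_left)
    then show ?case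
      using Suc by (simp only: Ck_on.simps) (auto intro: differentiableI[OF deriv])
  qed
qed

section \<open>Reflections, tangent vectors and paths of unitaries\<close>

definition reflect :: "'e \<Rightarrow> 'e" where
  "reflect P = 2 *\<^sub>R P - \<one>"

text \<open>For a projection \<open>P\<close>, anticommuting with \<open>reflect P\<close> is the
  linearised idempotence P H + H P = H; \<open>tangent_space_eq\<close> identifies this set with the
  tangent space.\<close>

definition tangents :: "'e \<Rightarrow> 'e set" where
  "tangents P = {H. adj H = H \<and> reflect P \<odot> H = - (H \<odot> reflect P)}"

definition generator :: "'e \<Rightarrow> 'e \<Rightarrow> 'e" where
  "generator P v = 2 *\<^sub>R (reflect P \<odot> v)"

definition geo :: "'e \<Rightarrow> 'e \<Rightarrow> real \<Rightarrow> 'e" where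
  "geo P v t = (1/2) *\<^sub>R (\<one> + reflect P \<odot> flow (generator P v) t)"

lemma refl_geo: "reflect (geo P v t) = reflect P \<odot> flow (generator P v) t"
  by (simp add: reflect_def geo_def)

lemma eq_of_refl_eq: "reflect P = reflect Q \<Longrightarrow> P = Q"
  by (simp add: reflect_def)

text \<open>A path from \<open>P\<close> to \<open>Q\<close> is encoded by unitaries that move
  \<open>P\<close>. Such paths are composed by pointwise products, so the composite is continuously
  differentiable without any corner, and the resulting path of projections has finite
  length.\<close>

definition conj_connected :: "'e \<Rightarrow> 'e \<Rightarrow> bool" where
  "conj_connected P Q \<longleftrightarrow>
    (\<exists>u u'. (\<forall>t::real. unitary (u t)) \<and> u 0 = \<one> \<and> u 1 \<odot> P \<odot> adj (u 1) = Q \<and>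
      (\<forall>t. (u has_vector_derivative u' t) (at t)) \<and> continuous_on UNIV u')"

lemma conj_connected_refl: "conj_connected P P"
  unfolding conj_connected_def
  by (rule exI[of _ "\<lambda>_. \<one>"], rule exI[of _ "\<lambda>_. 0"], intro conjI allI)
    (simp_all add: unitary_def)

lemma conj_connected_flow:
  assumes "skew k"
  shows "conj_connected P (flow k 1 \<odot> P \<odot> adj (flow k 1))"
  unfolding conj_connected_def
proof (rule exI[of _ "flow k"], rule exI[of _ "\<lambda>t. flow k t \<odot> k"], intro conjI allI)
  show "unitary (flow k t)" for t
    by (rule unitary_flow[OF assms])
  show "(flow k has_vector_derivative flow k t \<odot> k) (at t)" for t
    by (rule flow_has_vector_derivative)
  have "continuous_on UNIV (flow k)"
    by (rule has_vector_derivative_imp_continuous_on[OF flow_has_vector_derivative])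
  then show "continuous_on UNIV (\<lambda>t. flow k t \<odot> k)"
    by (intro mul.continuous_on continuous_on_const)
qed simp_all

lemma conj_connected_trans:
  assumes "conj_connected P Q" "conj_connected Q R"
  shows "conj_connected P R"
proof -
  obtain u u' where u: "\<forall>t::real. unitary (u t)" "u 0 = \<one>" "u 1 \<odot> P \<odot> adj (u 1) = Q"
    "\<forall>t. (u has_vector_derivative u' t) (at t)" "continuous_on UNIV u'"
    using assms(1) unfolding conj_connected_def by (elim exE conjE)
  obtain v v' where v: "\<forall>t::real. unitary (v t)" "v 0 = \<one>" "v 1 \<odot> Q \<odot> adj (v 1) = R"
    "\<forall>t. (v has_vector_derivative v' t) (at t)" "continuous_on UNIV v'"
    using assms(2) unfolding conj_connected_def by (elim exE conjE)
  have cont: "continuous_on UNIV u" "continuous_on UNIV v"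
    by (rule has_vector_derivative_imp_continuous_on[OF u(4)[rule_format]]
        has_vector_derivative_imp_continuous_on[OF v(4)[rule_format]])+
  show ?thesis
    unfolding conj_connected_def
  proof (rule exI[of _ "\<lambda>t. v t \<odot> u t"], rule exI[of _ "\<lambda>t. v t \<odot> u' t + v' t \<odot> u t"], intro conjI allI)
    show "unitary (v t \<odot> u t)" for t
      using u(1) v(1) by (simp add: unitary_mul)
    show "v 1 \<odot> u 1 \<odot> P \<odot> adj (v 1 \<odot> u 1) = R"
      unfolding v(3)[symmetric] u(3)[symmetric] by (simp add: adj_mul mul_assoc)
    show "((\<lambda>t. v t \<odot> u t) has_vector_derivative v t \<odot> u' t + v' t \<odot> u t) (at t)" for t
      using u(4) v(4) by (intro mul.has_vector_derivative) auto
    show "continuous_on UNIV (\<lambda>t. v t \<odot> u' t + v' t \<odot> u t)"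
      by (intro continuous_on_add mul.continuous_on cont u v)
  qed (simp add: u v)
qed

lemma subspace_tangents: "subspace (tangents P)"
  by (auto simp: subspace_def tangents_def adj.zero adj.add adj.scaleR mul.zero_left mul.zero_right
      mul.add_left mul.add_right mul.scaleR_left mul.scaleR_right)

end

subsection \<open>Geodesics on a manifold of projections\<close>

text \<open>Invariance under unitary conjugation keeps geodesics and doubled points inside
  \<open>M\<close>; \<open>conj_path\<close> makes the set of path lengths nonempty, so that
  \<open>riem_dist\<close> is a genuine infimum.\<close>

locale projection_manifold = star_algebra +
  fixes M :: "'a set"
  assumes idem: "P \<in> M \<Longrightarrow> P \<odot> P = P"
    and adj_eq: "P \<in> M \<Longrightarrow> adj P = P"
    and conj_mem: "P \<in> M \<Longrightarrow> unitary u \<Longrightarrow> u \<odot> P \<odot> adj u \<in> M"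
    and conj_path: "P \<in> M \<Longrightarrow> Q \<in> M \<Longrightarrow> conj_connected P Q"
begin

lemma refl_refl: "P \<in> M \<Longrightarrow> reflect P \<odot> reflect P = \<one>"
  by (simp add: reflect_def mul_simps idem scaleR_2)

lemma refl_refl_left: "P \<in> M \<Longrightarrow> reflect P \<odot> (reflect P \<odot> x) = x"
  by (metis refl_refl mul_assoc one_mul)

lemma adj_refl: "P \<in> M \<Longrightarrow> adj (reflect P) = reflect P"
  by (simp add: reflect_def adj.diff adj.scaleR adj_eq)

lemma inner_refl_conj:
  assumes "P \<in> M"
  shows "inner (reflect P \<odot> x \<odot> reflect P) z = inner x (reflect P \<odot> z \<odot> reflect P)"
  unfolding inner_mul_right[of "reflect P \<odot> x" "reflect P"] inner_mul_left[of "reflect P" x]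
  by (simp add: adj_refl assms mul_assoc)

lemma unitary_refl: "P \<in> M \<Longrightarrow> unitary (reflect P)"
  by (simp add: unitary_def adj_refl refl_refl)

lemma skew_generator:
  assumes "P \<in> M" "v \<in> tangents P"
  shows "skew (generator P v)"
  using assms by (simp add: skew_def generator_def adj.scaleR adj_mul adj_refl tangents_def adj.neg)

lemma refl_generator:
  assumes "P \<in> M" "v \<in> tangents P"
  shows "reflect P \<odot> generator P v = 2 *\<^sub>R v"
  using assms by (simp add: generator_def mul.scaleR_right refl_refl_left)

lemma norm_generator: "P \<in> M \<Longrightarrow> norm (generator P v) = 2 * norm v"
  by (simp add: generator_def norm_unitary_mul unitary_refl)

text \<open>The reflection anticommutes with the generator, so conjugation by it inverts the
  one-parameter group.\<close>

lemma refl_flow: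
  assumes P: "P \<in> M" and v: "v \<in> tangents P"
  shows "reflect P \<odot> flow (generator P v) t = flow (generator P v) (- t) \<odot> reflect P"
proof -
  let ?k = "generator P v"
  have "reflect P \<odot> ?k \<odot> reflect P = - ?k"
    using v by (simp add: generator_def mul_simps tangents_def refl_refl refl_refl_left P)
  then have "reflect P \<odot> flow ?k t \<odot> reflect P = flow ?k (- t)"
    using unitary_conj_flow[OF skew_generator[OF P v] unitary_refl[OF P], of t] adj_refl[OF P]
    by (simp add: flow_minus skew_generator P v)
  then show ?thesis
    by (metis mul_assoc mul_one refl_refl[OF P])
qed

text \<open>Half of the exponential is carried to the left of the reflection, where its sign flips.
  The geodesic thereby becomes an orbit of \<open>P\<close> under unitary conjugation and stays in
  \<open>M\<close>.\<close>

lemma geo_eq_conj: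
  assumes P: "P \<in> M" and v: "v \<in> tangents P"
  shows "geo P v t = flow (generator P v) (- (t/2)) \<odot> P \<odot> adj (flow (generator P v) (- (t/2)))"
proof (rule eq_of_refl_eq)
  let ?k = "generator P v"
  note k = skew_generator[OF P v]
  have "reflect P \<odot> flow ?k t = reflect P \<odot> flow ?k (t/2) \<odot> flow ?k (t/2)"
    by (simp add: mul_assoc flip: flow_add[OF k])
  also have "\<dots> = flow ?k (- (t/2)) \<odot> reflect P \<odot> flow ?k (t/2)"
    by (simp add: refl_flow P v)
  also have "\<dots> = reflect (flow ?k (- (t/2)) \<odot> P \<odot> flow ?k (t/2))"
    by (simp add: reflect_def mul_simps flow_add[OF k, symmetric])
  finally show "reflect (geo P v t) = reflect (flow ?k (- (t/2)) \<odot> P \<odot> adj (flow ?k (- (t/2))))"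
    by (simp add: refl_geo adj_flow[OF k])
qed

lemma geo_mem: "P \<in> M \<Longrightarrow> v \<in> tangents P \<Longrightarrow> geo P v t \<in> M"
  by (simp add: geo_eq_conj conj_mem unitary_flow skew_generator)

lemma geo_zero [simp]: "geo P v 0 = P"
  by (rule eq_of_refl_eq) (simp add: refl_geo)

lemma geo_has_vector_derivative:
  "(geo P v has_vector_derivative (1/2) *\<^sub>R (reflect P \<odot> flow (generator P v) t \<odot> generator P v)) (at t)"
  unfolding geo_def
  using has_vector_derivative_mul_const[OF flow_has_vector_derivative, of "reflect P" "generator P v" \<one> t]
  by (auto intro!: derivative_eq_intros simp: mul_assoc)

lemma geo_has_vector_derivative_0:
  "P \<in> M \<Longrightarrow> v \<in> tangents P \<Longrightarrow> (geo P v has_vector_derivative v) (at 0)"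
  using geo_has_vector_derivative[of P v 0] by (simp add: refl_generator)

lemma smooth_geo:
  assumes "P \<in> M" "v \<in> tangents P"
  shows "smooth_on S (geo P v)"
proof -
  have "geo P v = (\<lambda>t. (1/2) *\<^sub>R \<one> + (1/2) *\<^sub>R reflect P \<odot> flow (generator P v) t)"
    by (simp add: geo_def fun_eq_iff scaleR_add_right mul.scaleR_left)
  then show ?thesis
    using Ck_on_flow[OF skew_generator[OF assms]] by (auto intro!: smooth_onI)
qed

lemma velocity_mem_tangents:
  assumes e: "e > 0" and g: "g ` {-e<..<e} \<subseteq> M" "g 0 = P" and d: "(g has_vector_derivative v) (at 0)"
  shows "v \<in> tangents P"
proof -
  have mem: "g s \<in> M" if "s \<in> {-e<..<e}" for s
    using g(1) that by auto
  have "((\<lambda>s. adj (g s)) has_vector_derivative adj v) (at 0)"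
    using d by (rule adj.has_vector_derivative)
  then have "(g has_vector_derivative adj v) (at 0)"
    by (rule has_vector_derivative_transform_within_open[of _ _ _ "{-e<..<e}"]) (use e mem adj_eq in auto)
  then have adj: "adj v = v"
    using d vector_derivative_unique_at by blast
  have "((\<lambda>s. g s \<odot> g s) has_vector_derivative (P \<odot> v + v \<odot> P)) (at 0)"
    using mul.has_vector_derivative[OF d d] g(2) by simp
  then have "(g has_vector_derivative (P \<odot> v + v \<odot> P)) (at 0)"
    by (rule has_vector_derivative_transform_within_open[of _ _ _ "{-e<..<e}"]) (use e mem idem in auto)
  then have "P \<odot> v + v \<odot> P = v"
    using d vector_derivative_unique_at by blast
  then have "reflect P \<odot> v = - (v \<odot> reflect P)"
    by (simp add: reflect_def mul_simps eq_neg_iff_add_eq_0 algebra_simps flip: scaleR_add_right)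
      (simp add: scaleR_2)
  with adj show ?thesis
    by (simp add: tangents_def)
qed

lemma tangent_space_eq:
  assumes P: "P \<in> M"
  shows "tangent_space M P = tangents P"
proof (intro equalityI subsetI)
  fix v
  assume "v \<in> tangents P"
  then have "smooth_curve_through M P v (geo P v)"
    unfolding smooth_curve_through_def
    using P smooth_geo geo_mem geo_has_vector_derivative_0 by (auto intro!: exI[of _ 1])
  then show "v \<in> tangent_space M P"
    by (auto simp: tangent_space_def)
next
  fix v
  assume "v \<in> tangent_space M P"
  then show "v \<in> tangents P"
    by (auto simp: tangent_space_def smooth_curve_through_def intro: velocity_mem_tangents)
qed

text \<open>\<open>tangential_proj\<close> is a \<open>THE\<close>; orthogonal decomposition along
  the subspace of tangent vectors supplies the unique existence.\<close>

lemma tangential_proj_eq_0_iff: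
  assumes P: "P \<in> M"
  shows "tangential_proj M P x = 0 \<longleftrightarrow> (\<forall>z\<in>tangents P. inner x z = 0)"
proof -
  have unique: "\<exists>!y. y \<in> tangents P \<and> (\<forall>z\<in>tangents P. inner (x - y) z = 0)"
  proof -
    obtain y w where y: "y \<in> span (tangents P)" "\<And>z. z \<in> span (tangents P) \<Longrightarrow> orthogonal w z" "x = y + w"
      using orthogonal_subspace_decomp_exists[of "tangents P" x] by metis
    show ?thesis
    proof (rule ex1I[of _ y])
      show "y \<in> tangents P \<and> (\<forall>z\<in>tangents P. inner (x - y) z = 0)"
        using y subspace_tangents by (auto simp: orthogonal_def span_superset[THEN subsetD] span_eq_iff[THEN iffD2])
      fix y'
      assume y': "y' \<in> tangents P \<and> (\<forall>z\<in>tangents P. inner (x - y') z = 0)"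
      have "y - y' \<in> tangents P"
        using y' y(1) subspace_tangents by (simp add: span_eq_iff[THEN iffD2] subspace_diff)
      then have "inner (x - y') (y - y') = 0" "inner w (y - y') = 0"
        using y' y(2)[OF span_base] by (auto simp: orthogonal_def)
      then have "inner (y - y') (y - y') = 0"
        using y(3) by (simp add: inner_diff_left inner_add_left)
      then show "y' = y"
        by simp
    qed
  qed
  show ?thesis
    unfolding tangential_proj_def tangent_space_eq[OF P]
    using theI'[OF unique] the1_equality[OF unique, of 0] subspace_0[OF subspace_tangents, of P] by auto
qed

text \<open>The generator anticommutes with the initial reflection and commutes with its own flow,
  hence anticommutes with the reflection at every point of the geodesic.\<close>

lemma generator_refl_geo:
  assumes P: "P \<in> M" and v: "v \<in> tangents P"
  shows "generator P v \<odot> reflect (geo P v t) = - (reflect (geo P v t) \<odot> generator P v)"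
    using v flow_comm[OF skew_generator[OF assms], of t]
    by (simp add: refl_geo generator_def mul_simps tangents_def)
       (metis (no_types, lifting) mul.minus_left mul.minus_right mul_assoc mul.scaleR_left mul.scaleR_right)

text \<open>The acceleration is half of \<open>?R \<odot> (?k \<odot> ?k)\<close>. It commutes with
  \<open>?R\<close>, because \<open>?k\<close> anticommutes with it and occurs twice. Conjugation by
  \<open>?R\<close> preserves inner products, fixes the acceleration and negates tangent vectors, so
  the two are orthogonal.\<close>

lemma geodesic_geo:
  assumes P: "P \<in> M" and v: "v \<in> tangents P"
  shows "geodesic M (geo P v)"
  unfolding geodesic_def
proof (intro conjI allI)
  show "smooth_on UNIV (geo P v)"
    by (rule smooth_geo[OF assms])
  show "range (geo P v) \<subseteq> M"
    using geo_mem[OF assms] by blast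
  fix t
  let ?k = "generator P v"
  let ?R = "reflect (geo P v t)"
  have mem: "geo P v t \<in> M"
    by (rule geo_mem[OF assms])
  have "((\<lambda>s. (1/2) *\<^sub>R (reflect P \<odot> flow ?k s \<odot> ?k)) has_vector_derivative
      (1/2) *\<^sub>R (reflect P \<odot> (flow ?k t \<odot> ?k) \<odot> ?k)) (at t)"
    by (intro bounded_linear.has_vector_derivative[OF bounded_linear_scaleR_right]
        has_vector_derivative_mul_const flow_has_vector_derivative)
  then have second: "vector_derivative (\<lambda>s. vector_derivative (geo P v) (at s)) (at t) = (1/2) *\<^sub>R (?R \<odot> (?k \<odot> ?k))"
    by (simp add: vector_derivative_at[OF geo_has_vector_derivative] vector_derivative_at refl_geo mul_assoc)
  have anti: "?k \<odot> ?R = - (?R \<odot> ?k)"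
    by (rule generator_refl_geo[OF assms])
  have "inner (?R \<odot> (?k \<odot> ?k)) z = 0" if "z \<in> tangents (geo P v t)" for z
  proof -
    have z: "?R \<odot> z = - (z \<odot> ?R)"
      using that by (simp add: tangents_def)
    have "?k \<odot> ?k \<odot> ?R = ?R \<odot> (?k \<odot> ?k)"
      by (metis anti minus_minus mul.minus_left mul.minus_right mul_assoc)
    then have "inner (?R \<odot> (?k \<odot> ?k)) z = inner (?R \<odot> (?R \<odot> (?k \<odot> ?k)) \<odot> ?R) z"
      by (simp add: mul_assoc refl_refl_left mem)
    also have "\<dots> = inner (?R \<odot> (?k \<odot> ?k)) (?R \<odot> z \<odot> ?R)"
      by (rule inner_refl_conj[OF mem])
    also have "\<dots> = - inner (?R \<odot> (?k \<odot> ?k)) z"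
      by (simp add: z mul_simps refl_refl mem)
    finally show ?thesis
      by simp
  qed
  then show "tangential_proj M (geo P v t) (vector_derivative (\<lambda>s. vector_derivative (geo P v) (at s)) (at t)) = 0"
    by (simp add: second tangential_proj_eq_0_iff mem)
qed

text \<open>The velocity multiplied by the reflection is a conserved quantity of the geodesic
  equation. Once it is constant, the reflection solves the linear equation of
  \<open>skew_ode_unique\<close>, whose solution is known.\<close>

lemma geodesic_eq_geo:
  assumes g: "geodesic M g" and P: "g 0 = P" and v: "(g has_vector_derivative v) (at 0)"
  shows "v \<in> tangents P" "g t = geo P v t"
proof -
  define d where "d s = vector_derivative g (at s)" for s
  define e where "e s = vector_derivative d (at s)" for s
  have mem: "g s \<in> M" for s
    using g by (auto simp: geodesic_def)
  have smooth: "smooth_on UNIV g"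
    using g by (simp add: geodesic_def)
  have d: "(g has_vector_derivative d s) (at s)" and e: "(d has_vector_derivative e s) (at s)" for s
    using smooth_on_UNIV_vector_derivatives[OF smooth, of s] by (simp_all add: d_def[abs_def] e_def)
  have normal: "inner (e s) z = 0" if "z \<in> tangents (g s)" for s z
    using g that tangential_proj_eq_0_iff[OF mem, of s "e s"]
    by (simp add: geodesic_def e_def d_def[abs_def])
  let ?R = "\<lambda>s. reflect (g s)"
  have R: "(?R has_vector_derivative 2 *\<^sub>R d s) (at s)" for s
    unfolding reflect_def by (auto intro!: derivative_eq_intros d)
  have tan: "d s \<in> tangents (g s)" for s
  proof (rule velocity_mem_tangents[of 1 "\<lambda>r. g (s + r)"])
    have "((\<lambda>r. s + r) has_vector_derivative 1) (at 0)"
      by (auto intro!: derivative_eq_intros)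
    from vector_diff_chain_at[OF this, of g "d s"]
    show "((\<lambda>r. g (s + r)) has_vector_derivative d s) (at 0)"
      using d by (simp add: o_def)
  qed (use mem in auto)
  then have anti: "?R s \<odot> d s = - (d s \<odot> ?R s)" for s
    by (simp add: tangents_def)
  have adj_e: "adj (e s) = e s" for s
  proof -
    have "((\<lambda>r. adj (d r)) has_vector_derivative adj (e s)) (at s)"
      by (rule adj.has_vector_derivative[OF e])
    moreover have "(\<lambda>r. adj (d r)) = d"
      using tan by (auto simp: tangents_def)
    ultimately have "(d has_vector_derivative adj (e s)) (at s)"
      by simp
    then show ?thesis
      using e by (rule vector_derivative_unique_at)
  qed
  have comm: "?R s \<odot> e s = e s \<odot> ?R s" for s
  proof -
    \<comment> \<open>Twice the part of the acceleration that anticommutes with the reflection. It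
      is tangent, so normality of the acceleration forces it to vanish.\<close>
    let ?z = "e s - ?R s \<odot> e s \<odot> ?R s"
    have z: "?z \<in> tangents (g s)"
      by (simp add: tangents_def adj.diff adj_mul adj_e adj_refl mem mul_simps refl_refl refl_refl_left)
    have "inner (?R s \<odot> e s \<odot> ?R s) ?z = inner (e s) (?R s \<odot> ?z \<odot> ?R s)"
      by (rule inner_refl_conj[OF mem])
    also have "?R s \<odot> ?z \<odot> ?R s = - ?z"
      by (simp add: mul_simps refl_refl refl_refl_left mem)
    finally have "inner ?z ?z = 0"
      using normal[OF z] unfolding inner_diff_left inner_diff_right inner_minus_right by linarith
    then have "?R s \<odot> e s = ?R s \<odot> (?R s \<odot> e s \<odot> ?R s)"
      by simp
    then show ?thesis
      by (simp add: mul_assoc refl_refl_left mem)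
  qed
  have zero: "?R s \<odot> e s + 2 *\<^sub>R (d s \<odot> d s) = 0" for s
  proof -
    \<comment> \<open>Differentiating the anticommutation of reflection and velocity gives, by
      \<open>comm\<close>, twice the derivative of their product.\<close>
    have "((\<lambda>r. ?R r \<odot> d r + d r \<odot> ?R r) has_vector_derivative
        (?R s \<odot> e s + 2 *\<^sub>R d s \<odot> d s) + (d s \<odot> 2 *\<^sub>R d s + e s \<odot> ?R s)) (at s)"
      by (intro has_vector_derivative_add mul.has_vector_derivative R e)
    moreover have "(\<lambda>r. ?R r \<odot> d r + d r \<odot> ?R r) = (\<lambda>r. 0)"
      by (simp add: anti)
    ultimately have "(?R s \<odot> e s + 2 *\<^sub>R d s \<odot> d s) + (d s \<odot> 2 *\<^sub>R d s + e s \<odot> ?R s) = 0"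
      using vector_derivative_unique_at has_vector_derivative_const by metis
    then have "2 *\<^sub>R (?R s \<odot> e s + 2 *\<^sub>R (d s \<odot> d s)) = 0"
      by (simp add: comm mul.scaleR_left mul.scaleR_right mul.add_left mul.add_right scaleR_2 algebra_simps)
    then show ?thesis
      by simp
  qed
  have Rd: "((\<lambda>r. ?R r \<odot> d r) has_vector_derivative 0) (at s within UNIV)" for s
    using mul.has_vector_derivative[OF R[of s] e[of s]] zero[of s] by (simp add: mul.scaleR_left)
  obtain c where "\<forall>s\<in>UNIV. ?R s \<odot> d s = c"
    using has_vector_derivative_zero_constant[OF convex_UNIV Rd] by blast
  then have "?R s \<odot> d s = ?R 0 \<odot> d 0" for s
    by simp
  moreover have d0: "d 0 = v"
    using d v by (rule vector_derivative_unique_at)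
  ultimately have "2 *\<^sub>R (?R s \<odot> d s) = generator P v" for s
    using P by (simp add: generator_def)
  then have R': "?R s \<odot> generator P v = 2 *\<^sub>R d s" for s
    by (simp add: mul.scaleR_right refl_refl_left mem flip: \<open>2 *\<^sub>R (?R s \<odot> d s) = generator P v\<close>)
  show v': "v \<in> tangents P"
    using tan[of 0] d0 P by simp
  have PM: "P \<in> M"
    using mem[of 0] P by simp
  have "?R t = reflect P \<odot> flow (generator P v) t"
  proof (rule skew_ode_unique[OF skew_generator[OF PM v']])
    show "(?R has_vector_derivative ?R s \<odot> generator P v) (at s)" for s
      using R by (simp add: R')
    show "((\<lambda>t. reflect P \<odot> flow (generator P v) t) has_vector_derivative
      reflect P \<odot> flow (generator P v) s \<odot> generator P v) (at s)" for s
      using has_vector_derivative_mul_const[OF flow_has_vector_derivative, of "reflect P" "generator P v" \<one> s]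
      by (simp add: mul_assoc)
  qed (simp add: P)
  then show "g t = geo P v t"
    unfolding refl_geo[symmetric] by (rule eq_of_refl_eq)
qed

lemma riem_exp_eq_geo:
  assumes "P \<in> M" "v \<in> tangents P"
  shows "riem_exp M P v = geo P v 1"
  unfolding riem_exp_def
proof (rule the_equality)
  show "\<exists>g. geodesic M g \<and> g 0 = P \<and> (g has_vector_derivative v) (at 0) \<and> g 1 = geo P v 1"
    using geodesic_geo[OF assms] geo_has_vector_derivative_0[OF assms] by force
  fix q
  assume "\<exists>g. geodesic M g \<and> g 0 = P \<and> (g has_vector_derivative v) (at 0) \<and> g 1 = q"
  then obtain g where "geodesic M g" "g 0 = P" "(g has_vector_derivative v) (at 0)" "g 1 = q"
    by blast
  with geodesic_eq_geo(2) show "q = geo P v 1"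
    by metis
qed

subsection \<open>The doubling map\<close>

text \<open>The geodesic symmetry at \<open>Q\<close> applied to \<open>A\<close>, written in terms
  of reflections.\<close>

definition double :: "'a \<Rightarrow> 'a \<Rightarrow> 'a" where
  "double A Q = (1/2) *\<^sub>R (\<one> + reflect Q \<odot> reflect A \<odot> reflect Q)"

lemma double_mem:
  assumes "A \<in> M" "Q \<in> M"
  shows "double A Q \<in> M"
proof -
  have "reflect Q \<odot> A \<odot> adj (reflect Q) = double A Q"
    using assms by (simp add: adj_refl double_def reflect_def[of A] mul_simps refl_refl)
  then show ?thesis
    using conj_mem[OF assms(1) unitary_refl[OF assms(2)]] by simp
qed

text \<open>The reflection at the midpoint is that of \<open>A\<close> times the half-time flow. In
  the triple product two adjacent reflections at \<open>A\<close> cancel and the two half-time flows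
  combine.\<close>

lemma double_geo:
  assumes "A \<in> M" "v \<in> tangents A"
  shows "double A (geo A v (1/2)) = geo A v 1"
proof -
  have "reflect A \<odot> flow (generator A v) (1/2) \<odot> reflect A \<odot> (reflect A \<odot> flow (generator A v) (1/2))
      = reflect A \<odot> flow (generator A v) 1"
    by (simp add: mul_assoc refl_refl_left assms(1) skew_generator[OF assms] flip: flow_add)
  then show ?thesis
    unfolding double_def refl_geo by (simp add: geo_def)
qed

section \<open>Path lengths and the distance\<close>

lemma path_lengths_nonneg:
  "L \<in> path_lengths N p q \<Longrightarrow> 0 \<le> L"
  by (auto simp: path_lengths_def intro: has_integral_nonneg)

lemma path_lengths_nonempty:
  assumes "P \<in> M" "Q \<in> M"
  shows "path_lengths M P Q \<noteq> {}"
proof -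
  obtain u u' where u: "\<And>t::real. unitary (u t)" "u 0 = \<one>" "u 1 \<odot> P \<odot> adj (u 1) = Q"
    "\<And>t. (u has_vector_derivative u' t) (at t)" "continuous_on UNIV u'"
    using conj_path[OF assms] unfolding conj_connected_def by metis
  define g where "g t = u t \<odot> P \<odot> adj (u t)" for t
  define g' where "g' t = u t \<odot> P \<odot> adj (u' t) + u' t \<odot> P \<odot> adj (u t)" for t
  have g': "(g has_vector_derivative g' t) (at t)" for t
    unfolding g_def g'_def
    by (intro mul.has_vector_derivative adj.has_vector_derivative u
        bounded_linear.has_vector_derivative[OF mul.bounded_linear_left])
  have cont_u: "continuous_on {0..1} u"
    by (intro continuous_at_imp_continuous_on ballI) (metis u(4) has_vector_derivative_continuous)
  have cont_u': "continuous_on {0..1} u'"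
    using u(5) continuous_on_subset by blast
  have cont: "continuous_on {0..1} g'"
    unfolding g'_def
    by (intro continuous_intros mul.continuous_on adj.continuous_on cont_u cont_u')
  have "g C1_differentiable_on {0..1}"
    unfolding C1_differentiable_on_def using g' cont by blast
  then have "valid_path g"
    by (simp add: valid_path_def C1_differentiable_imp_piecewise)
  moreover have "path_image g \<subseteq> M"
    using conj_mem[OF assms(1) u(1)] by (auto simp: path_image_def g_def)
  moreover have "pathstart g = P" "pathfinish g = Q"
    using u by (simp_all add: pathstart_def pathfinish_def g_def)
  moreover have "((\<lambda>t. norm (vector_derivative g (at t))) has_integral integral {0..1} (\<lambda>t. norm (g' t))) {0..1}"
    unfolding vector_derivative_at[OF g']
    by (intro integrable_integral integrable_continuous_interval continuous_intros cont)
  ultimately show ?thesis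
    unfolding path_lengths_def by blast
qed

text \<open>\<open>E\<close> is the velocity of the image path: two terms, each the velocity of
  \<open>g\<close> multiplied by reflections, whence the factor 2. Since \<open>valid_path\<close>
  does not control the derivative near the corners, integrability of the new speed is obtained from
  measurability off \<open>S\<close> and domination by twice the old one.\<close>

lemma path_lengths_double:
  assumes A: "A \<in> M" and L: "L \<in> path_lengths M P Q"
  obtains L' where "L' \<in> path_lengths M (double A P) (double A Q)" "L' \<le> 2 * L"
proof -
  obtain g where g: "valid_path g" "path_image g \<subseteq> M" "pathstart g = P" "pathfinish g = Q"
    and int: "((\<lambda>t. norm (vector_derivative g (at t))) has_integral L) {0..1}"
    using L by (auto simp: path_lengths_def)
  from g(1) obtain S D where cont: "continuous_on {0..1} g" and S: "finite S"
    and D_all: "\<forall>t\<in>{0..1} - S. (g has_vector_derivative D t) (at t)"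
    and cont_D: "continuous_on ({0..1} - S) D"
    by (auto simp: valid_path_def piecewise_C1_differentiable_on_def C1_differentiable_on_def)
  have D: "(g has_vector_derivative D t) (at t)" if "t \<in> {0..1} - S" for t
    using D_all that by blast
  have mem: "g t \<in> M" if "t \<in> {0..1}" for t
    using g(2) that by (auto simp: path_image_def)
  let ?T = "{0..1} - S"
  let ?R = "\<lambda>t. reflect (g t)"
  define h where "h t = double A (g t)" for t
  define E where "E t = ?R t \<odot> reflect A \<odot> D t + D t \<odot> reflect A \<odot> ?R t" for t
  have cont_R: "continuous_on {0..1} ?R"
    unfolding reflect_def by (intro continuous_intros cont)
  have E: "(h has_vector_derivative E t) (at t)" if "t \<in> ?T" for t
  proof -
    have R: "(?R has_vector_derivative 2 *\<^sub>R D t) (at t)"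
      unfolding reflect_def using D[OF that] by (auto intro!: derivative_eq_intros)
    have "((\<lambda>t. (1/2) *\<^sub>R (\<one> + ?R t \<odot> reflect A \<odot> ?R t)) has_vector_derivative
        (1/2) *\<^sub>R (0 + (?R t \<odot> reflect A \<odot> 2 *\<^sub>R D t + 2 *\<^sub>R D t \<odot> reflect A \<odot> ?R t))) (at t)"
      by (intro bounded_linear.has_vector_derivative[OF bounded_linear_scaleR_right]
          has_vector_derivative_add has_vector_derivative_const mul.has_vector_derivative
          bounded_linear.has_vector_derivative[OF mul.bounded_linear_left] R)
    moreover have "(\<lambda>t. (1/2) *\<^sub>R (\<one> + ?R t \<odot> reflect A \<odot> ?R t)) = h"
      by (simp add: h_def double_def fun_eq_iff)
    moreover have "(1/2) *\<^sub>R (0 + (?R t \<odot> reflect A \<odot> 2 *\<^sub>R D t + 2 *\<^sub>R D t \<odot> reflect A \<odot> ?R t)) = E t"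
      by (simp add: E_def mul.scaleR_left mul.scaleR_right scaleR_add_right)
    ultimately show ?thesis
      by simp
  qed
  have cont_E: "continuous_on ?T E"
    unfolding E_def
    by (intro continuous_intros mul.continuous_on cont_D continuous_on_subset[OF cont_R]) auto
  have norm_E: "norm (E t) \<le> 2 * norm (vector_derivative g (at t))" if "t \<in> ?T" for t
  proof -
    have "norm (E t) \<le> norm (?R t \<odot> reflect A \<odot> D t) + norm (D t \<odot> reflect A \<odot> ?R t)"
      unfolding E_def by (rule norm_triangle_ineq)
    also have "\<dots> = 2 * norm (D t)"
      using that mem[of t] A by (simp add: norm_unitary_mul norm_mul_unitary unitary_mul unitary_refl mul_assoc[of "D t"])
    finally show ?thesis
      using D[OF that] by (simp add: vector_derivative_at)
  qed
  have spike: "(f has_integral y) ?T \<longleftrightarrow> (f has_integral y) {0..1}" for f :: "real \<Rightarrow> real" and y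
    by (rule has_integral_spike_set_eq) (rule negligible_subset[OF negligible_finite[OF S]], auto)+
  have int_g: "((\<lambda>t. 2 * norm (vector_derivative g (at t))) has_integral 2 * L) ?T"
    unfolding spike by (intro has_integral_mult_right int)
  have meas: "?T \<in> sets lebesgue"
    using S by (intro sets.Diff) (auto intro: negligible_imp_sets negligible_finite)
  have "(\<lambda>t. norm (E t)) integrable_on ?T"
  proof (rule measurable_bounded_by_integrable_imp_integrable_real)
    show "(\<lambda>t. norm (E t)) \<in> borel_measurable (lebesgue_on ?T)"
      by (intro continuous_imp_measurable_on_sets_lebesgue continuous_on_norm cont_E meas)
    show "(\<lambda>t. 2 * norm (vector_derivative g (at t))) integrable_on ?T"
      using int_g by (rule has_integral_integrable)
    show "\<bar>norm (E t)\<bar> \<le> 2 * norm (vector_derivative g (at t))" if "t \<in> ?T" for t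
      using norm_E[OF that] by simp
  qed (rule meas)
  then obtain L' where L': "((\<lambda>t. norm (E t)) has_integral L') ?T"
    unfolding integrable_on_def by (rule exE)
  show ?thesis
  proof (rule that)
    show "L' \<le> 2 * L"
      using L' int_g norm_E by (rule has_integral_le)
    have "((\<lambda>t. norm (vector_derivative h (at t))) has_integral L') ?T"
      using L' by (rule has_integral_eq[rotated]) (simp add: vector_derivative_at[OF E])
    then have "((\<lambda>t. norm (vector_derivative h (at t))) has_integral L') {0..1}"
      by (simp only: spike)
    moreover have "valid_path h"
      unfolding valid_path_def piecewise_C1_differentiable_on_def C1_differentiable_on_def
    proof (intro conjI exI ballI)
      show "continuous_on {0..1} h"
        unfolding h_def double_def by (intro continuous_intros mul.continuous_on cont_R)
    qed (use S E cont_E in auto)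
    moreover have "path_image h \<subseteq> M"
      using double_mem[OF A mem] by (auto simp: path_image_def h_def)
    moreover have "pathstart h = double A P" "pathfinish h = double A Q"
      using g by (simp_all add: pathstart_def pathfinish_def h_def)
    ultimately show "L' \<in> path_lengths M (double A P) (double A Q)"
      unfolding path_lengths_def by blast
  qed
qed

lemma riem_dist_double:
  assumes "A \<in> M" "P \<in> M" "Q \<in> M"
  shows "riem_dist M (double A P) (double A Q) / 2 \<le> riem_dist M P Q"
  unfolding riem_dist_def[of M P Q]
proof (rule cInf_greatest)
  show "path_lengths M P Q \<noteq> {}"
    by (rule path_lengths_nonempty[OF assms(2,3)])
  fix L
  assume "L \<in> path_lengths M P Q"
  then obtain L' where L': "L' \<in> path_lengths M (double A P) (double A Q)" "L' \<le> 2 * L"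
    using path_lengths_double[OF assms(1)] by blast
  have "riem_dist M (double A P) (double A Q) \<le> L'"
    unfolding riem_dist_def using L'(1) by (intro cInf_lower bdd_belowI[of _ 0] path_lengths_nonneg)
  then show "riem_dist M (double A P) (double A Q) / 2 \<le> L"
    using L'(2) by simp
qed

end

context star_algebra
begin

subsection \<open>The Gauss lemma\<close>

lemma flow_minus_has_vector_derivative:
  assumes "skew k"
  shows "((\<lambda>s. flow k (- s)) has_vector_derivative - (k \<odot> flow k (- s))) (at s)"
proof -
  have "skew (- k)"
    using assms by (simp add: skew_def adj.neg)
  have "flow k (- s) = flow (- k) s" for s
    by (simp add: flow_minus assms)
  then show ?thesis
    using flow_has_vector_derivative[of "- k" s] flow_comm[OF \<open>skew (- k)\<close>, of s]
    by (simp add: mul.minus_left mul.minus_right)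
qed

text \<open>The derivative of the product in \<open>s\<close> is \<open>l - k\<close> between two
  unitary factors, so it has constant norm and the mean value inequality applies.\<close>

lemma norm_flow_diff_le:
  assumes "skew k" "skew l" "0 \<le> s" "s \<le> 1"
  shows "norm (flow l s \<odot> flow k (- s) - \<one>) \<le> norm (l - k)"
proof (cases "s = 0")
  case False
  let ?V = "\<lambda>s. flow l s \<odot> flow k (- s)"
  have V: "(?V has_vector_derivative flow l x \<odot> (l - k) \<odot> flow k (- x)) (at x)" for x
    using mul.has_vector_derivative[OF flow_has_vector_derivative[of l x] flow_minus_has_vector_derivative[OF assms(1), of x]]
    by (simp add: mul_simps)
  have "\<exists>x\<in>{0<..<s}. norm (?V s - ?V 0) \<le> norm ((s - 0) *\<^sub>R (flow l x \<odot> (l - k) \<odot> flow k (- x)))"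
  proof (rule mvt_general)
    show "continuous_on {0..s} ?V"
      by (intro continuous_at_imp_continuous_on ballI) (metis V has_vector_derivative_continuous)
  qed (use False assms(3) V in \<open>auto simp: has_vector_derivative_def\<close>)
  then obtain x where "norm (?V s - ?V 0) \<le> norm (s *\<^sub>R (flow l x \<odot> (l - k) \<odot> flow k (- x)))"
    by auto
  also have "\<dots> = s * norm (l - k)"
    using assms by (simp add: norm_unitary_mul norm_mul_unitary unitary_flow)
  also have "\<dots> \<le> norm (l - k)"
    using assms by (simp add: mult_left_le_one_le)
  finally show ?thesis
    by simp
qed simp

text \<open>As \<open>k\<close> commutes with its own flow, that flow can be moved cyclically inside
  the inner product. The derivative of \<open>?h\<close> is then the product of \<open>l - k\<close>
  with an element close to \<open>\<one>\<close>, paired with \<open>k\<close>. By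
  \<open>norm_flow_diff_le\<close> the deviation from \<open>\<one>\<close> is at most the norm of
  \<open>l - k\<close>, which makes the error quadratic; \<open>C\<close> bounds the
  multiplication.\<close>

lemma gauss_estimate:
  obtains C where "C \<ge> 0"
    "\<And>k l. skew k \<Longrightarrow> skew l \<Longrightarrow>
      inner k (l - k) - C * norm k * (norm (l - k))\<^sup>2 \<le> inner k (flow k (- 1) \<odot> flow l 1 - \<one>)"
proof -
  obtain C where C: "C > 0" "\<And>x y. norm (x \<odot> y) \<le> norm x * norm y * C"
    using mul.pos_bounded by blast
  show ?thesis
  proof (rule that[of C])
    fix k l
    assume k: "skew k" and l: "skew l"
    let ?h = "\<lambda>s. inner k (flow k (- s) \<odot> flow l s)"
    let ?h' = "\<lambda>s. inner k ((l - k) \<odot> (flow l s \<odot> flow k (- s)))"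
    have h: "(?h has_real_derivative ?h' s) (at s)" for s
    proof -
      have "((\<lambda>s. flow k (- s) \<odot> flow l s) has_vector_derivative
          flow k (- s) \<odot> (l - k) \<odot> flow l s) (at s)"
        using mul.has_vector_derivative[OF flow_minus_has_vector_derivative[OF k, of s] flow_has_vector_derivative[of l s]]
          flow_comm[OF k, of "- s"] flow_comm[OF l, of s]
        by (simp add: mul_simps)
      then have "(?h has_vector_derivative inner k (flow k (- s) \<odot> (l - k) \<odot> flow l s)) (at s)"
        by (rule bounded_linear.has_vector_derivative[OF bounded_linear_inner_right])
      moreover have "inner k (flow k (- s) \<odot> (l - k) \<odot> flow l s) = ?h' s"
      proof -
        have "inner (flow k (- s) \<odot> ((l - k) \<odot> flow l s)) k = inner ((l - k) \<odot> flow l s) (k \<odot> flow k s)"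
          by (simp add: inner_mul_left[of "flow k (- s)"] adj_flow k flow_comm)
        also have "\<dots> = inner ((l - k) \<odot> (flow l s \<odot> flow k (- s))) k"
          using inner_mul_right[of "(l - k) \<odot> flow l s" "flow k (- s)" k] by (simp add: adj_flow k mul_assoc)
        finally show ?thesis
          by (simp add: inner_commute mul_assoc)
      qed
      ultimately show ?thesis
        by (simp add: has_real_derivative_iff_has_vector_derivative)
    qed
    obtain s where s: "0 < s" "s < 1" "?h 1 - ?h 0 = (1 - 0) * ?h' s"
      using MVT2[of 0 1 ?h ?h'] h by auto
    let ?e = "flow l s \<odot> flow k (- s) - \<one>"
    have "\<bar>inner k ((l - k) \<odot> ?e)\<bar> \<le> norm k * norm ((l - k) \<odot> ?e)"
      by (rule Cauchy_Schwarz_ineq2)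
    also have "\<dots> \<le> norm k * (norm (l - k) * norm ?e * C)"
      using C by (intro mult_left_mono) auto
    also have "\<dots> \<le> norm k * (norm (l - k) * norm (l - k) * C)"
      using C norm_flow_diff_le[OF k l, of s] s
      by (intro mult_left_mono mult_right_mono) auto
    finally have "\<bar>inner k ((l - k) \<odot> ?e)\<bar> \<le> C * norm k * (norm (l - k))\<^sup>2"
      by (simp add: power2_eq_square mult_ac)
    moreover have "?h' s = inner k (l - k) + inner k ((l - k) \<odot> ?e)"
      by (simp add: mul.diff_right inner_diff_right)
    moreover have "inner k (flow k (- 1) \<odot> flow l 1 - \<one>) = ?h' s"
      using s(3) by (simp add: inner_diff_right)
    ultimately show "inner k (l - k) - C * norm k * (norm (l - k))\<^sup>2 \<le> inner k (flow k (- 1) \<odot> flow l 1 - \<one>)"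
      by linarith
  qed (use C in auto)
qed

text \<open>The radial component of the derivative of the exponential map is computed exactly: by
  \<open>gauss_estimate\<close> the error is quadratic, so its derivative vanishes at the base point.\<close>

lemma inner_flow_derivative_le:
  assumes T: "open T" "t \<in> T" "\<And>s. s \<in> T \<Longrightarrow> skew (K s)"
    and K: "(K has_vector_derivative K') (at t)"
    and W: "((\<lambda>s. flow (K s) 1) has_vector_derivative W') (at t)"
  shows "inner (K t) K' \<le> norm (K t) * norm W'"
proof -
  obtain C where C: "C \<ge> 0" "\<And>k l. skew k \<Longrightarrow> skew l \<Longrightarrow>
      inner k (l - k) - C * norm k * (norm (l - k))\<^sup>2 \<le> inner k (flow k (- 1) \<odot> flow l 1 - \<one>)"
    by (rule gauss_estimate) blast
  let ?k = "K t"
  have k: "skew ?k"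
    by (rule T)+
  \<comment> \<open>The slack in \<open>gauss_estimate\<close> between \<open>K t\<close> and
    \<open>K s\<close>. It is nonnegative near \<open>t\<close> and zero at \<open>t\<close>, so
    \<open>t\<close> is a local minimum; the quadratic term contributes nothing to the derivative
    there.\<close>
  define f where "f s = inner ?k (flow ?k (- 1) \<odot> flow (K s) 1 - \<one>) - inner ?k (K s - ?k)
      + C * norm ?k * inner (K s - ?k) (K s - ?k)" for s
  have "(f has_vector_derivative (inner ?k (flow ?k (- 1) \<odot> W' - 0) - inner ?k (K' - 0)
      + C * norm ?k * (inner (K t - ?k) (K' - 0) + inner (K' - 0) (K t - ?k)))) (at t)"
    unfolding f_def
    by (intro has_vector_derivative_add has_vector_derivative_diff has_vector_derivative_const K W
        bounded_linear.has_vector_derivative[OF bounded_linear_inner_right]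
        bounded_linear.has_vector_derivative[OF mul.bounded_linear_right]
        bounded_linear.has_vector_derivative[OF bounded_linear_mult_right]
        bounded_bilinear.has_vector_derivative[OF bounded_bilinear_inner])
  then have f': "(f has_real_derivative inner ?k (flow ?k (- 1) \<odot> W') - inner ?k K') (at t)"
    by (simp add: has_real_derivative_iff_has_vector_derivative)
  have ft: "f t = 0"
    by (simp add: f_def flip: flow_add[OF k])
  have f_nonneg: "0 \<le> f s" if "s \<in> T" for s
    using C(2)[OF k T(3)[OF that]] by (simp add: f_def power2_norm_eq_inner)
  obtain d where "d > 0" "ball t d \<subseteq> T"
    using T(1,2) open_contains_ball by blast
  then have "inner ?k (flow ?k (- 1) \<odot> W') - inner ?k K' = 0"
    using f_nonneg by (intro DERIV_local_min[OF f', of d]) (auto simp: ft dist_real_def subset_iff)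
  moreover have "inner ?k (flow ?k (- 1) \<odot> W') \<le> norm ?k * norm (flow ?k (- 1) \<odot> W')"
    by (rule norm_cauchy_schwarz)
  ultimately show ?thesis
    by (simp add: norm_unitary_mul unitary_flow k)
qed

end

context projection_manifold
begin

text \<open>Multiplying the reflection of \<open>g s\<close> by that of \<open>A\<close> isolates
  the flow of the generator, to which \<open>inner_flow_derivative_le\<close> applies. The generator
  doubles norms and the reflection doubles velocities, so both sides carry the factor 4.\<close>

lemma radial_velocity_le:
  assumes A: "A \<in> M" and T: "open T" "t \<in> T"
    and v: "\<And>s. s \<in> T \<Longrightarrow> v s \<in> tangents A"
    and g: "\<And>s. s \<in> T \<Longrightarrow> geo A (v s) 1 = g s"
    and v': "(v has_vector_derivative v') (at t)"
    and g': "(g has_vector_derivative g') (at t)"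
  shows "inner (v t) v' \<le> norm (v t) * norm g'"
proof -
  let ?K = "\<lambda>s. generator A (v s)"
  have K': "(?K has_vector_derivative 2 *\<^sub>R (reflect A \<odot> v')) (at t)"
    unfolding generator_def
    by (intro bounded_linear.has_vector_derivative[OF bounded_linear_scaleR_right]
        bounded_linear.has_vector_derivative[OF mul.bounded_linear_right] v')
  have "((\<lambda>s. reflect A \<odot> reflect (g s)) has_vector_derivative reflect A \<odot> (2 *\<^sub>R g' - 0)) (at t)"
    unfolding reflect_def[of "g _"]
    by (intro bounded_linear.has_vector_derivative[OF mul.bounded_linear_right]
        has_vector_derivative_diff has_vector_derivative_const
        bounded_linear.has_vector_derivative[OF bounded_linear_scaleR_right] g')
  moreover have "reflect A \<odot> reflect (g s) = flow (?K s) 1" if "s \<in> T" for s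
    using g[OF that, symmetric] by (simp add: refl_geo refl_refl_left A)
  ultimately have W': "((\<lambda>s. flow (?K s) 1) has_vector_derivative reflect A \<odot> (2 *\<^sub>R g' - 0)) (at t)"
    using T by (blast intro: has_vector_derivative_transform_within_open)
  have "inner (?K t) (2 *\<^sub>R (reflect A \<odot> v')) \<le> norm (?K t) * norm (reflect A \<odot> (2 *\<^sub>R g' - 0))"
    using T skew_generator[OF A v] K' W' by (rule inner_flow_derivative_le)
  moreover have "inner (?K t) (2 *\<^sub>R (reflect A \<odot> v')) = 4 * inner (v t) v'"
    by (simp add: generator_def inner_mul_left adj_refl A refl_refl_left)
  ultimately show ?thesis
    by (simp add: norm_generator norm_unitary_mul unitary_refl A mult_ac)
qed

section \<open>Openness of the exponential map\<close>

lemma dim_tangents_conj: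
  assumes "unitary u"
  shows "dim (tangents (u \<odot> P \<odot> adj u)) \<le> dim (tangents P)"
proof -
  let ?Q = "u \<odot> P \<odot> adj u"
  define h where "h X = adj u \<odot> X \<odot> u" for X
  have "linear h"
    unfolding h_def
    by (intro linearI) (simp_all add: mul.add_left mul.add_right mul.scaleR_left mul.scaleR_right)
  moreover have "inj h"
  proof (rule inj_on_inverseI)
    show "u \<odot> h X \<odot> adj u = X" for X
      using assms by (simp add: h_def mul_assoc unitary_cancel unitary_def)
  qed
  ultimately have "dim (tangents ?Q) = dim (h ` tangents ?Q)"
    by (metis dim_image_eq inj_on_subset subset_UNIV)
  also have "\<dots> \<le> dim (tangents P)"
  proof (rule dim_subset, rule image_subsetI)
    fix X
    assume "X \<in> tangents ?Q"
    then have X: "adj X = X" "reflect ?Q \<odot> X = - (X \<odot> reflect ?Q)"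
      by (simp_all add: tangents_def)
    have "reflect P = h (reflect ?Q)"
      using assms by (simp add: h_def reflect_def mul_simps unitary_cancel unitary_def)
    then have "reflect P \<odot> h X = h (reflect ?Q \<odot> X)" "h X \<odot> reflect P = h (X \<odot> reflect ?Q)"
      using assms by (simp_all add: h_def mul_assoc unitary_cancel)
    then show "h X \<in> tangents P"
      using X \<open>linear h\<close> by (simp add: tangents_def linear_neg) (simp add: h_def adj_mul mul_assoc)
  qed
  finally show ?thesis .
qed

text \<open>The chart takes twice the part of \<open>P\<close> that anticommutes with the reflection
  at \<open>Q\<close>. If two points have the same image, their difference \<open>?D\<close>
  commutes with \<open>?r\<close>. Subtracting the equations saying that both reflections square to
  \<open>\<one>\<close> expresses twice \<open>?r \<odot> ?D\<close> through products of
  \<open>?D\<close> with the small differences from \<open>?r\<close>. The radius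
  \<open>1 / (2 * C)\<close> makes the resulting coefficient smaller than 2, so \<open>?D\<close>
  vanishes.\<close>

lemma tangential_chart_inj:
  assumes Q: "Q \<in> M"
  obtains \<delta> where "\<delta> > 0"
    "\<And>P P'. P \<in> M \<Longrightarrow> P' \<in> M \<Longrightarrow> dist P Q < \<delta> \<Longrightarrow> dist P' Q < \<delta> \<Longrightarrow>
      P - reflect Q \<odot> P \<odot> reflect Q = P' - reflect Q \<odot> P' \<odot> reflect Q \<Longrightarrow> P = P'"
proof -
  obtain C where C: "C > 0" "\<And>x y. norm (x \<odot> y) \<le> norm x * norm y * C"
    using mul.pos_bounded by blast
  let ?r = "reflect Q"
  show ?thesis
  proof (rule that[of "1 / (2 * C)"])
    fix P P'
    assume P: "P \<in> M" "P' \<in> M" and near: "dist P Q < 1 / (2 * C)" "dist P' Q < 1 / (2 * C)"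
      and eq: "P - ?r \<odot> P \<odot> ?r = P' - ?r \<odot> P' \<odot> ?r"
    let ?D = "P - P'"
    have "?D = ?r \<odot> ?D \<odot> ?r"
      using eq by (simp add: mul.diff_left mul.diff_right algebra_simps)
    then have comm: "?r \<odot> ?D = ?D \<odot> ?r"
      by (metis mul_assoc refl_refl_left[OF Q])
    have "reflect P \<odot> reflect P - reflect P' \<odot> reflect P' = 0"
      by (simp add: refl_refl P)
    then have "2 *\<^sub>R (reflect P \<odot> ?D + ?D \<odot> reflect P') = 0"
      by (simp add: reflect_def mul_simps algebra_simps)
    then have "reflect P \<odot> ?D + ?D \<odot> reflect P' = 0"
      by simp
    then have "(reflect P - ?r) \<odot> ?D + ?D \<odot> (reflect P' - ?r) = - (2 *\<^sub>R (?r \<odot> ?D))"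
      using comm by (simp add: mul.diff_left[of _ ?r] mul.diff_right[of _ _ ?r] scaleR_2 algebra_simps)
    then have "2 * norm (?r \<odot> ?D) = norm ((reflect P - ?r) \<odot> ?D + ?D \<odot> (reflect P' - ?r))"
      by simp
    also have "\<dots> \<le> norm (reflect P - ?r) * norm ?D * C + norm ?D * norm (reflect P' - ?r) * C"
      by (rule norm_triangle_mono[OF C(2) C(2)])
    also have "\<dots> = 2 * C * (dist P Q + dist P' Q) * norm ?D"
    proof -
      have "reflect X - ?r = 2 *\<^sub>R (X - Q)" for X
        by (simp add: reflect_def algebra_simps)
      then have "norm (reflect X - ?r) = 2 * dist X Q" for X
        by (simp only: norm_scaleR dist_norm)
      then show ?thesis
        by (simp add: algebra_simps)
    qed
    finally have le: "2 * norm ?D \<le> 2 * C * (dist P Q + dist P' Q) * norm ?D"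
      by (simp add: norm_unitary_mul unitary_refl Q)
    have lt: "2 * C * (dist P Q + dist P' Q) < 2"
      using near C(1) by (simp add: field_simps)
    show "P = P'"
    proof (rule ccontr)
      assume "P \<noteq> P'"
      then have "norm ?D > 0"
        by simp
      with lt have "2 * C * (dist P Q + dist P' Q) * norm ?D < 2 * norm ?D"
        by (rule mult_strict_right_mono)
      then show False
        using le by simp
    qed
  qed (use C in simp)
qed

text \<open>Invariance of domain, applied in a tangential chart, replaces the inverse function theorem.\<close>

lemma exp_image_open:
  assumes A: "A \<in> M"
    and cont: "continuous_on {v \<in> tangents A. norm v < R} (\<lambda>v. geo A v 1)"
    and inj: "inj_on (\<lambda>v. geo A v 1) {v \<in> tangents A. norm v < R}"
    and v: "v \<in> tangents A" "norm v < R"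
  obtains \<delta> where "\<delta> > 0"
    "\<And>Q. Q \<in> M \<Longrightarrow> dist Q (geo A v 1) < \<delta> \<Longrightarrow> Q \<in> (\<lambda>v. geo A v 1) ` {v \<in> tangents A. norm v < R}"
proof -
  let ?U = "{v \<in> tangents A. norm v < R}"
  let ?e = "\<lambda>v. geo A v 1"
  let ?Q = "?e v"
  have Q: "?Q \<in> M"
    by (rule geo_mem[OF A v(1)])
  let ?k = "\<lambda>X. X - reflect ?Q \<odot> X \<odot> reflect ?Q"
  obtain \<delta>0 where \<delta>0: "\<delta>0 > 0"
    "\<And>P P'. P \<in> M \<Longrightarrow> P' \<in> M \<Longrightarrow> dist P ?Q < \<delta>0 \<Longrightarrow> dist P' ?Q < \<delta>0 \<Longrightarrow> ?k P = ?k P' \<Longrightarrow> P = P'"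
    using tangential_chart_inj[OF Q] by blast
  \<comment> \<open>Restricted to vectors whose exponential lies where the chart is injective, so
    that chart after exponential is injective.\<close>
  define S where "S = ?U \<inter> ?e -` ball ?Q \<delta>0"
  have e_mem: "?e w \<in> M" if "w \<in> ?U" for w
    using geo_mem[OF A] that by blast
  have k_mem: "?k P \<in> tangents ?Q" if "P \<in> M" for P
    using that Q by (simp add: tangents_def adj.diff adj_mul adj_refl adj_eq mul_simps refl_refl_left refl_refl)
  have cont_k: "continuous_on X ?k" for X
    by (intro continuous_intros mul.continuous_on)
  have U_open: "openin (top_of_set (tangents A)) ?U"
  proof -
    have "?U = tangents A \<inter> ball 0 R"
      by auto
    then show ?thesis
      by (simp add: openin_open_Int)
  qed
  have "openin (top_of_set ?U) S"
    unfolding S_def by (rule continuous_openin_preimage_gen[OF cont open_ball])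
  then have S_open: "openin (top_of_set (tangents A)) S"
    using U_open by (rule openin_trans)
  have "openin (top_of_set (tangents ?Q)) ((?k \<circ> ?e) ` S)"
  proof (rule invariance_of_domain_subspaces[OF S_open subspace_tangents subspace_tangents])
    \<comment> \<open>The endpoint of a geodesic is a unitary conjugate of \<open>A\<close>, which
      yields the dimension condition of invariance of domain.\<close>
    show "dim (tangents ?Q) \<le> dim (tangents A)"
      unfolding geo_eq_conj[OF A v(1)]
      by (rule dim_tangents_conj[OF unitary_flow[OF skew_generator[OF A v(1)]]])
    show "continuous_on S (?k \<circ> ?e)"
      by (intro continuous_on_compose cont_k continuous_on_subset[OF cont]) (auto simp: S_def)
    show "?k \<circ> ?e \<in> S \<rightarrow> tangents ?Q"
      using k_mem e_mem by (auto simp: S_def)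
    show "inj_on (?k \<circ> ?e) S"
    proof (rule inj_onI)
      fix w w'
      assume w: "w \<in> S" "w' \<in> S" and "(?k \<circ> ?e) w = (?k \<circ> ?e) w'"
      then have "?e w = ?e w'"
        using \<delta>0(2)[of "?e w" "?e w'"] e_mem by (auto simp: S_def dist_commute)
      then show "w = w'"
        using inj w by (auto simp: S_def inj_on_def)
    qed
  qed
  moreover have "?k ?Q \<in> (?k \<circ> ?e) ` S"
    using v \<delta>0(1) by (auto simp: S_def)
  ultimately obtain \<epsilon> where \<epsilon>: "\<epsilon> > 0" "ball (?k ?Q) \<epsilon> \<inter> tangents ?Q \<subseteq> (?k \<circ> ?e) ` S"
    by (meson openin_contains_ball)
  have "isCont ?k ?Q"
    using cont_k[of UNIV] by (simp add: continuous_on_eq_continuous_at)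
  then obtain \<delta>1 where \<delta>1: "\<delta>1 > 0" "\<And>Q'. dist Q' ?Q < \<delta>1 \<Longrightarrow> dist (?k Q') (?k ?Q) < \<epsilon>"
    using continuous_at_eps_delta[THEN iffD1, rule_format, OF _ \<epsilon>(1)] by blast
  show ?thesis
  proof (rule that[of "min \<delta>0 \<delta>1"])
    show "min \<delta>0 \<delta>1 > 0"
      using \<delta>0(1) \<delta>1(1) by simp
    fix Q'
    assume Q': "Q' \<in> M" "dist Q' ?Q < min \<delta>0 \<delta>1"
    then have "?k Q' \<in> ball (?k ?Q) \<epsilon> \<inter> tangents ?Q"
      using \<delta>1(2)[of Q'] k_mem by (simp add: dist_commute)
    then obtain w where w: "w \<in> S" "?k Q' = ?k (?e w)"
      using \<epsilon>(2) by (auto simp: image_iff subset_iff)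
    \<comment> \<open>Invariance of domain only produces a vector with the same chart value;
      injectivity of the chart identifies the points themselves.\<close>
    then have "Q' = ?e w"
      using \<delta>0(2)[of Q' "?e w"] Q' e_mem by (auto simp: S_def dist_commute)
    then show "Q' \<in> ?e ` ?U"
      using w(1) by (auto simp: S_def)
  qed
qed

subsection \<open>Lifting paths through the exponential map\<close>

text \<open>By \<open>radial_velocity_le\<close> the norm of the lift grows no faster than the path
  moves. As the norm is not differentiable at 0, it is replaced by the smooth function
  \<open>h\<close>, which differs from it by at most \<open>e\<close>.\<close>

lemma norm_lift_le:
  assumes A: "A \<in> M" and "t \<le> s" and S: "finite S"
    and cont: "continuous_on {t..s} v"
    and v: "\<And>x. x \<in> {t<..<s} \<Longrightarrow> v x \<in> tangents A"
    and g: "\<And>x. x \<in> {t<..<s} \<Longrightarrow> geo A (v x) 1 = g x"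
    and v': "\<And>x. x \<in> {t<..<s} - S \<Longrightarrow> (v has_vector_derivative v' x) (at x)"
    and g': "\<And>x. x \<in> {t<..<s} - S \<Longrightarrow> (g has_vector_derivative g' x) (at x)"
    and int: "((\<lambda>x. norm (g' x)) has_integral L) {t..s}"
  shows "norm (v s) \<le> norm (v t) + L"
proof (rule field_le_epsilon)
  fix e :: real
  assume e: "e > 0"
  define h where "h x = sqrt (e\<^sup>2 + inner (v x) (v x))" for x
  \<comment> \<open>At the excluded points the value \<open>norm (g' x)\<close> is chosen so that
    the pointwise comparison holds on the whole interval.\<close>
  define f where "f x = (if x \<in> {t<..<s} - S then inner (v x) (v' x) / h x else norm (g' x))" for x
  have pos: "e\<^sup>2 + inner (v x) (v x) > 0" for x
    using e by (simp add: add_pos_nonneg)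
  have h': "(h has_vector_derivative f x) (at x)" if x: "x \<in> {t<..<s} - S" for x
  proof -
    have "((\<lambda>x. e\<^sup>2 + inner (v x) (v x)) has_vector_derivative 0 + (inner (v x) (v' x) + inner (v' x) (v x))) (at x)"
      by (intro has_vector_derivative_add has_vector_derivative_const v'[OF x]
          bounded_bilinear.has_vector_derivative[OF bounded_bilinear_inner])
    then have "((\<lambda>x. e\<^sup>2 + inner (v x) (v x)) has_real_derivative 2 * inner (v x) (v' x)) (at x)"
      by (simp add: has_real_derivative_iff_has_vector_derivative inner_commute)
    from DERIV_chain2[OF DERIV_real_sqrt[OF pos] this]
    have "(h has_real_derivative inner (v x) (v' x) / h x) (at x)"
      by (simp add: h_def[abs_def] field_simps)
    then show ?thesis
      using x by (simp add: f_def has_real_derivative_iff_has_vector_derivative)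
  qed
  have "(f has_integral (h s - h t)) {t..s}"
    using S \<open>t \<le> s\<close> h'
  proof (rule fundamental_theorem_of_calculus_interior_strong)
    show "continuous_on {t..s} h"
      unfolding h_def by (intro continuous_intros cont)
  qed
  moreover have "f x \<le> norm (g' x)" for x
  proof (cases "x \<in> {t<..<s} - S")
    case True
    have "inner (v x) (v' x) \<le> norm (v x) * norm (g' x)"
      by (rule radial_velocity_le[OF A open_greaterThanLessThan[of t s]]) (use True v g v' g' in auto)
    also have "\<dots> \<le> h x * norm (g' x)"
      by (intro mult_right_mono) (auto simp: h_def norm_eq_sqrt_inner)
    finally have "inner (v x) (v' x) \<le> h x * norm (g' x)" .
    moreover have "h x > 0"
      using pos by (simp add: h_def)
    ultimately show ?thesis
      using True by (simp add: f_def divide_le_eq mult.commute)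
  qed (auto simp: f_def)
  ultimately have "h s - h t \<le> L"
    by (rule has_integral_le[OF _ int])
  moreover have "norm (v s) \<le> h s"
    by (simp add: h_def norm_eq_sqrt_inner)
  moreover have "h t \<le> e + norm (v t)"
    using sqrt_add_le_add_sqrt[of "e\<^sup>2" "inner (v t) (v t)"] e by (simp add: h_def norm_eq_sqrt_inner)
  ultimately show "norm (v s) \<le> norm (v t) + L + e"
    by simp
qed

text \<open>Continuous induction in time on the set \<open>G\<close> of times having a lift whose
  norm is within the budget \<open>l\<close>, the starting norm plus the length used so far. As the
  budget stays below \<open>R\<close>, lifts never reach the boundary of the ball on which the
  exponential is a diffeomorphism. The start \<open>v0\<close> is arbitrary because paths begin at
  the centre of the metric ball while lifts live in the tangent space at \<open>A\<close>.\<close>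

lemma norm_log_le_path_length:
  assumes A: "A \<in> M"
    and diffeo: "diffeo_onto_image {v \<in> tangent_space M A. norm v < R} (riem_exp M A)"
    and valid: "valid_path g" and g_M: "path_image g \<subseteq> M"
    and int: "((\<lambda>t. norm (vector_derivative g (at t))) has_integral L) {0..1}"
    and v0: "v0 \<in> tangents A" "geo A v0 1 = g 0" "norm v0 + L < R"
  shows "\<exists>v\<in>tangents A. norm v \<le> norm v0 + L \<and> geo A v 1 = g 1"
proof -
  let ?U = "{v \<in> tangents A. norm v < R}"
  let ?e = "\<lambda>v. geo A v 1"
  let ?sp = "\<lambda>t. norm (vector_derivative g (at t))"
  have E_eq: "riem_exp M A v = ?e v" if "v \<in> ?U" for v
    using that riem_exp_eq_geo[OF A] by blast
  define lg where "lg = inv_into ?U (riem_exp M A)"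
  have im_eq: "riem_exp M A ` ?U = ?e ` ?U"
    using E_eq by (intro image_cong) auto
  have smooth: "smooth_on ?U (riem_exp M A)" "inj_on (riem_exp M A) ?U" "smooth_on (?e ` ?U) lg"
    using diffeo im_eq by (simp_all add: diffeo_onto_image_def tangent_space_eq[OF A] lg_def)
  have cont_e: "continuous_on ?U ?e"
    using smooth_on_imp_continuous_on[OF smooth(1)] E_eq by (rule continuous_on_eq)
  have inj_e: "inj_on ?e ?U"
    by (rule inj_on_cong[THEN iffD1, rotated, OF smooth(2)]) (rule E_eq)
  have lg_mem: "lg Q \<in> ?U" "?e (lg Q) = Q" if "Q \<in> ?e ` ?U" for Q
  proof -
    have Q: "Q \<in> riem_exp M A ` ?U"
      using that im_eq by simp
    show "lg Q \<in> ?U"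
      unfolding lg_def using Q by (rule inv_into_into)
    then show "?e (lg Q) = Q"
      using E_eq f_inv_into_f[OF Q] by (simp add: lg_def)
  qed
  have lg_e: "lg (?e v) = v" if "v \<in> ?U" for v
    using lg_mem[of "?e v"] that inj_e by (auto dest: inj_onD)
  obtain S D where cont: "continuous_on {0..1} g" and S: "finite S"
    and D_all: "\<forall>t\<in>{0..1} - S. (g has_vector_derivative D t) (at t)"
    using valid by (auto simp: valid_path_def piecewise_C1_differentiable_on_def C1_differentiable_on_def)
  have D: "(g has_vector_derivative vector_derivative g (at t)) (at t)" if "t \<in> {0..1} - S" for t
    using D_all that vector_derivative_at by metis
  have mem: "g t \<in> M" if "t \<in> {0..1}" for t
    using g_M that by (auto simp: path_image_def)
  define l where "l t = norm v0 + integral {0..t} ?sp" for t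
  have sub_int: "?sp integrable_on {s..t}" if "0 \<le> s" "t \<le> 1" for s t
    using has_integral_integrable[OF int] by (rule integrable_on_subinterval) (use that in auto)
  have l_diff: "l t = l s + integral {s..t} ?sp" if "0 \<le> s" "s \<le> t" "t \<le> 1" for s t
    using Henstock_Kurzweil_Integration.integral_combine[OF that(1,2) sub_int[OF order.refl that(3)]]
    by (simp add: l_def)
  have l_mono: "l s \<le> l t" if "0 \<le> s" "s \<le> t" "t \<le> 1" for s t
    using l_diff[OF that] by (simp add: integral_nonneg sub_int that)
  have l1: "l 1 = norm v0 + L"
    using int by (simp add: l_def integral_unique)
  have lR: "l t < R" if "0 \<le> t" "t \<le> 1" for t
    using l_mono[of t 1] that v0(3) l1 by simp
  define G where "G = {t \<in> {0..1}. \<exists>v\<in>tangents A. norm v \<le> l t \<and> ?e v = g t}"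
  have right_open: "\<exists>b. t < b \<and> b \<le> 1 \<and> {t..b} \<subseteq> G" if t: "t \<in> G" "t < 1" for t
  proof -
    have t01: "t \<in> {0..1}"
      using t(1) by (simp add: G_def)
    obtain v where v: "v \<in> tangents A" "norm v \<le> l t" "?e v = g t"
      using t(1) by (auto simp: G_def)
    have vU: "v \<in> ?U"
      using v lR[of t] t01 by simp
    obtain \<delta> where \<delta>: "\<delta> > 0" "\<And>Q. Q \<in> M \<Longrightarrow> dist Q (g t) < \<delta> \<Longrightarrow> Q \<in> ?e ` ?U"
      using exp_image_open[OF A cont_e inj_e, of v] vU v(3) by auto
    obtain d where d: "d > 0" "\<And>s. s \<in> {0..1} \<Longrightarrow> dist s t < d \<Longrightarrow> dist (g s) (g t) < \<delta>"
      using cont[unfolded continuous_on_iff, rule_format, OF t01 \<delta>(1)] by blast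
    define b where "b = min 1 (t + d / 2)"
    have b: "t < b" "b \<le> 1" "b < t + d"
      using t(2) d(1) by (auto simp: b_def min_def)
    have img: "g s \<in> ?e ` ?U" if "s \<in> {t..b}" for s
      using that b t01 by (intro \<delta>(2) mem d(2)) (auto simp: dist_real_def)
    let ?v = "\<lambda>s. lg (g s)"
    have cont_v: "continuous_on {t..b} ?v"
    proof (rule continuous_on_compose2[OF smooth_on_imp_continuous_on[OF smooth(3)]])
      show "continuous_on {t..b} g"
        using cont by (rule continuous_on_subset) (use b t01 in auto)
    qed (use img in blast)
    have v_diff: "\<exists>v'. (?v has_vector_derivative v') (at x)" if x: "x \<in> {t<..<b} - S" for x
    proof -
      have x01: "x \<in> {0..1} - S"
        using x t01 b by auto
      have gx: "g x \<in> ?e ` ?U"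
        using img[of x] x by auto
      \<comment> \<open>\<open>lg\<close> is smooth only on the image, a subset of \<open>M\<close>;
        the chain rule along \<open>g\<close> needs its local extension \<open>F\<close> to an open
        set.\<close>
      obtain V F where V: "open V" "g x \<in> V" "\<forall>m. Ck_on m V F" "\<forall>y\<in>V \<inter> ?e ` ?U. F y = lg y"
        using smooth(3) gx by (rule smooth_onE)
      have "Ck_on (Suc 0) V F"
        using V(3) by (rule spec)
      then have "F differentiable (at (g x))"
        using V(2) by simp
      then obtain F' where F': "(F has_derivative F') (at (g x))"
        by (auto simp: differentiable_def)
      have "((F \<circ> g) has_derivative F' \<circ> (\<lambda>h. h *\<^sub>R vector_derivative g (at x))) (at x)"
        using D[OF x01] F' unfolding has_vector_derivative_def by (rule diff_chain_at)
      then have Fg: "(F \<circ> g) differentiable (at x)"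
        by (rule differentiableI)
      have W: "open ({t<..<b} \<inter> g -` V)"
        by (rule continuous_open_preimage[OF continuous_on_subset[OF cont] _ V(1)]) (use t01 b in auto)
      have "((F \<circ> g) has_vector_derivative vector_derivative (F \<circ> g) (at x)) (at x)"
        using Fg by (simp add: vector_derivative_works)
      then have "(?v has_vector_derivative vector_derivative (F \<circ> g) (at x)) (at x)"
        using W
      proof (rule has_vector_derivative_transform_within_open)
        show "x \<in> {t<..<b} \<inter> g -` V"
          using x V(2) by simp
        fix y
        assume "y \<in> {t<..<b} \<inter> g -` V"
        then have "g y \<in> V \<inter> ?e ` ?U"
          using img[of y] by auto
        then show "(F \<circ> g) y = ?v y"
          using V(4) by simp
      qed
      then show ?thesis
        by blast
    qed
    have "s \<in> G" if s: "s \<in> {t..b}" for s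
    proof -
      have s01: "0 \<le> t" "t \<le> s" "s \<le> 1"
        using s t01 b by auto
      have "norm (?v s) \<le> norm (?v t) + integral {t..s} ?sp"
      proof (rule norm_lift_le[OF A s01(2) S])
        show "continuous_on {t..s} ?v"
          using cont_v by (rule continuous_on_subset) (use s in auto)
        show "?v x \<in> tangents A" "geo A (?v x) 1 = g x" if "x \<in> {t<..<s}" for x
          using lg_mem[OF img[of x]] that s by auto
        show "(?v has_vector_derivative vector_derivative ?v (at x)) (at x)" if "x \<in> {t<..<s} - S" for x
          using v_diff[of x] that s by (auto simp: vector_derivative_at)
        show "(g has_vector_derivative vector_derivative g (at x)) (at x)" if "x \<in> {t<..<s} - S" for x
          using D[of x] that s01 by auto
        show "(?sp has_integral integral {t..s} ?sp) {t..s}"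
          using sub_int[OF s01(1,3)] by (rule integrable_integral)
      qed
      \<comment> \<open>Injectivity identifies the local lift with the vector \<open>v\<close> at
        time \<open>t\<close>, so the budget already known for \<open>v\<close> starts the
        estimate.\<close>
      also have "?v t = v"
        using lg_e[OF vU] v(3) by simp
      finally have "norm (?v s) \<le> l s"
        using v(2) l_diff[OF s01] by simp
      then show ?thesis
        using lg_mem[OF img[OF s]] s01 by (auto simp: G_def)
    qed
    then show ?thesis
      using b by blast
  qed
  have closed: "t \<in> G" if t: "0 < t" "t \<le> 1" and below: "{0..<t} \<subseteq> G" for t
  proof -
    \<comment> \<open>A compact ball inside the domain, so its exponential image is closed. It
      contains \<open>g\<close> at all earlier positive times, hence also at time
      \<open>t\<close>.\<close>
    let ?B = "tangents A \<inter> cball 0 (l t)"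
    have "compact ?B"
      by (intro closed_Int_compact closed_subspace subspace_tangents compact_cball)
    moreover have "?B \<subseteq> ?U"
      using lR[of t] t by auto
    ultimately have "closed (?e ` ?B)"
      by (intro compact_imp_closed compact_continuous_image continuous_on_subset[OF cont_e])
    then have "closed ({0..t} \<inter> g -` (?e ` ?B))"
      by (intro continuous_closed_preimage continuous_on_subset[OF cont]) (use t in auto)
    moreover have "{0<..<t} \<subseteq> {0..t} \<inter> g -` (?e ` ?B)"
    proof
      fix s
      assume s: "s \<in> {0<..<t}"
      then have "s \<in> G"
        using below by auto
      then obtain v where "v \<in> tangents A" "norm v \<le> l s" "?e v = g s"
        by (auto simp: G_def)
      moreover have "l s \<le> l t"
        using l_mono[of s t] s t by auto
      ultimately show "s \<in> {0..t} \<inter> g -` (?e ` ?B)"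
        using s by (auto intro!: image_eqI[of _ _ v])
    qed
    ultimately have sub: "closure {0<..<t} \<subseteq> {0..t} \<inter> g -` (?e ` ?B)"
      by (rule closure_minimal[rotated])
    have "t \<in> closure {0<..<t}"
      using t(1) by (simp add: closure_greaterThanLessThan)
    then have "t \<in> g -` (?e ` ?B)"
      using sub by (rule IntD2[OF subsetD, rotated])
    then have "g t \<in> ?e ` ?B"
      by (rule vimageD)
    then show ?thesis
      using t by (auto simp: G_def)
  qed
  \<comment> \<open>Initial segments, since \<open>G\<close> itself is not known to be an
    interval.\<close>
  define X where "X = {t \<in> {0..1}. {0..t} \<subseteq> G}"
  have "0 \<in> G"
    using v0 by (auto simp: G_def l_def)
  then have X0: "0 \<in> X"
    by (auto simp: X_def)
  have bdd: "bdd_above X"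
    by (auto simp: X_def bdd_above_def)
  define T where "T = Sup X"
  have le_T: "t \<le> T" if "t \<in> X" for t
    unfolding T_def using that bdd by (rule cSup_upper)
  have T01: "0 \<le> T" "T \<le> 1"
  proof -
    show "0 \<le> T"
      by (rule le_T[OF X0])
    show "T \<le> 1"
      unfolding T_def
    proof (rule cSup_least)
      show "X \<noteq> {}"
        using X0 by blast
    qed (simp add: X_def)
  qed
  have below: "{0..<T} \<subseteq> G"
  proof
    fix s
    assume s: "s \<in> {0..<T}"
    have "X \<noteq> {}"
      using X0 by blast
    then obtain t where "t \<in> X" "s < t"
      using less_cSupD[of X s] s by (auto simp: T_def)
    then show "s \<in> G"
      using s by (auto simp: X_def)
  qed
  have "T \<in> G"
    using closed[of T] below T01 \<open>0 \<in> G\<close> by (cases "T = 0") auto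
  have "T = 1"
  proof (rule ccontr)
    assume "T \<noteq> 1"
    then obtain b where b: "T < b" "b \<le> 1" "{T..b} \<subseteq> G"
      using right_open[OF \<open>T \<in> G\<close>] T01 by auto
    have "{0..b} \<subseteq> {0..<T} \<union> {T..b}"
      by auto
    then have "b \<in> X"
      using b T01 below unfolding X_def by auto
    then show False
      using le_T[of b] b(1) by simp
  qed
  with \<open>T \<in> G\<close> show ?thesis
    by (simp add: G_def l1)
qed

lemma geo_zero_velocity:
  assumes "P \<in> M"
  shows "geo P 0 t = P"
proof (rule eq_of_refl_eq)
  have "skew 0"
    by (simp add: skew_def adj.zero)
  then have "flow 0 t = \<one>"
    using flow_scaleR[of 0 0 t] by simp
  then show "reflect (geo P 0 t) = reflect P"
    by (simp add: refl_geo generator_def mul.zero_right)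
qed

text \<open>The witness is the negative of the final velocity; its generator is the negative of the
  original one, so its flow undoes the geodesic.\<close>

lemma geo_reverse:
  assumes P: "P \<in> M" and w: "w \<in> tangents P"
  shows "\<exists>v\<in>tangents (geo P w 1). norm v = norm w \<and> geo (geo P w 1) v 1 = P"
proof -
  let ?Q = "geo P w 1"
  let ?k = "generator P w"
  let ?v = "- (1/2) *\<^sub>R (reflect ?Q \<odot> ?k)"
  have Q: "?Q \<in> M"
    by (rule geo_mem[OF assms])
  have k: "skew ?k"
    by (rule skew_generator[OF assms])
  have anti: "?k \<odot> reflect ?Q = - (reflect ?Q \<odot> ?k)"
    by (rule generator_refl_geo[OF assms])
  have "adj (reflect ?Q \<odot> ?k) = reflect ?Q \<odot> ?k"
    using k anti by (simp add: adj_mul adj_refl Q skew_def mul.minus_left)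
  then have v: "?v \<in> tangents ?Q"
    using anti by (simp add: tangents_def adj.scaleR adj.neg mul_simps refl_refl_left refl_refl Q)
  have "generator ?Q ?v = - ?k"
    by (simp add: generator_def mul_simps refl_refl_left Q)
  then have "reflect (geo ?Q ?v 1) = reflect P"
    by (simp add: refl_geo flow_minus k mul_assoc flip: flow_add[OF k])
  moreover have "norm ?v = norm w"
    by (simp add: norm_unitary_mul unitary_refl Q norm_generator P)
  ultimately show ?thesis
    using v eq_of_refl_eq by blast
qed

subsection \<open>Logarithms and geometric means\<close>

lemma less_inj_radiusE:
  assumes "A \<in> M" "ereal x < inj_radius M"
  obtains R where "x < R" "diffeo_onto_image {v \<in> tangent_space M A. norm v < R} (riem_exp M A)"
proof -
  have "ereal x < inj_radius_at M A"
    using assms(2) INF_lower[OF assms(1), of "inj_radius_at M"] by (simp add: inj_radius_def)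
  then show ?thesis
    using that by (auto simp: inj_radius_at_def less_Sup_iff)
qed

text \<open>Both vectors fit into one ball on which the exponential is a diffeomorphism; this is the
  uniqueness behind the \<open>THE\<close> in \<open>riem_log\<close>.\<close>

lemma exp_inj:
  assumes A: "A \<in> M" and v: "v \<in> tangents A" "ereal (norm v) < inj_radius M"
    and w: "w \<in> tangents A" "ereal (norm w) < inj_radius M"
    and eq: "riem_exp M A v = riem_exp M A w"
  shows "v = w"
proof -
  have "ereal (max (norm v) (norm w)) < inj_radius M"
    using v(2) w(2) by (simp add: max_def)
  with A obtain R where R: "max (norm v) (norm w) < R"
    "diffeo_onto_image {v \<in> tangent_space M A. norm v < R} (riem_exp M A)"
    by (rule less_inj_radiusE)
  then have "inj_on (riem_exp M A) {v \<in> tangents A. norm v < R}"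
    by (simp add: diffeo_onto_image_def tangent_space_eq[OF A])
  then show ?thesis
    using eq by (rule inj_onD) (use v w R(1) in auto)
qed

lemma geom_mean_eq_geo:
  assumes A: "A \<in> M" and v: "v \<in> tangents A" "ereal (norm v) < inj_radius M"
  shows "geom_mean M A (geo A v 1) = geo A v (1/2)"
proof -
  have "riem_log M A (geo A v 1) = v"
    unfolding riem_log_def tangent_space_eq[OF A]
  proof (rule the_equality)
    show "v \<in> tangents A \<and> ereal (norm v) < inj_radius M \<and> riem_exp M A v = geo A v 1"
      using v riem_exp_eq_geo[OF A v(1)] by simp
    fix w
    assume "w \<in> tangents A \<and> ereal (norm w) < inj_radius M \<and> riem_exp M A w = geo A v 1"
    then show "w = v"
      using exp_inj[OF A _ _ v, of w] riem_exp_eq_geo[OF A v(1)] by simp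
  qed
  moreover have "(1/2) *\<^sub>R v \<in> tangents A"
    using subspace_tangents v(1) by (rule subspace_scale)
  moreover have "generator A ((1/2) *\<^sub>R v) = (1/2) *\<^sub>R generator A v"
    by (simp add: generator_def mul.scaleR_right)
  ultimately show ?thesis
    by (simp add: geom_mean_def riem_exp_eq_geo[OF A] geo_def flow_scaleR[OF skew_generator[OF A v(1)]])
qed

text \<open>Two lifts are made. The path from \<open>Z\<close> to \<open>A\<close> is lifted at
  \<open>Z\<close>, and reversing the resulting geodesic gives \<open>v0\<close> at
  \<open>A\<close>, pointing to \<open>Z\<close> and shorter than \<open>r\<close>. The path from
  \<open>Z\<close> to \<open>B\<close> is then lifted at \<open>A\<close>, starting from
  \<open>v0\<close>. The total stays below \<open>2 * r\<close>, hence below the injectivity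
  radius.\<close>

lemma exists_log_in_ball:
  assumes Z: "Z \<in> M" and r: "ereal r < rho M" and A: "A \<in> riem_ball M Z r" and B: "B \<in> riem_ball M Z r"
  shows "\<exists>v\<in>tangents A. ereal (norm v) < inj_radius M \<and> geo A v 1 = B"
proof -
  have "ereal r < inj_radius M / 2"
    using r by (simp add: rho_def)
  then have r2: "ereal (2 * r) < inj_radius M"
    by (cases "inj_radius M") auto
  have path: "\<exists>g L. L < r \<and> valid_path g \<and> path_image g \<subseteq> M \<and> g 0 = Z \<and> g 1 = P \<and>
      ((\<lambda>t. norm (vector_derivative g (at t))) has_integral L) {0..1}"
    if "P \<in> riem_ball M Z r" for P
  proof -
    have "P \<in> M" "Inf (path_lengths M Z P) < r"
      using that by (simp_all add: riem_ball_def riem_dist_def)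
    then obtain L where "L \<in> path_lengths M Z P" "L < r"
      using cInf_lessD[OF path_lengths_nonempty[OF Z]] by blast
    then show ?thesis
      by (auto simp: path_lengths_def pathstart_def pathfinish_def)
  qed
  obtain g L where g: "L < r" "valid_path g" "path_image g \<subseteq> M" "g 0 = Z" "g 1 = A"
    "((\<lambda>t. norm (vector_derivative g (at t))) has_integral L) {0..1}"
    using path[OF A] by (elim exE conjE)
  obtain h K where h: "K < r" "valid_path h" "path_image h \<subseteq> M" "h 0 = Z" "h 1 = B"
    "((\<lambda>t. norm (vector_derivative h (at t))) has_integral K) {0..1}"
    using path[OF B] by (elim exE conjE)
  have L0: "0 \<le> L" "0 \<le> K"
    using g(6) h(6) by (auto intro: has_integral_nonneg)
  obtain R where R: "2 * r < R" "diffeo_onto_image {v \<in> tangent_space M Z. norm v < R} (riem_exp M Z)"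
    using Z r2 by (rule less_inj_radiusE)
  have "0 \<in> tangents Z" "geo Z 0 1 = g 0" "norm (0::'a) + L < R"
    using R(1) g(1,4) L0 geo_zero_velocity[OF Z] subspace_0[OF subspace_tangents] by auto
  from norm_log_le_path_length[OF Z R(2) g(2,3,6) this]
  obtain w where w: "w \<in> tangents Z" "norm w \<le> L" "geo Z w 1 = A"
    using g(5) by auto
  obtain v0 where v0: "v0 \<in> tangents A" "norm v0 = norm w" "geo A v0 1 = Z"
    using geo_reverse[OF Z w(1)] w(3) by auto
  have AM: "A \<in> M"
    using A by (simp add: riem_ball_def)
  obtain R' where R': "2 * r < R'" "diffeo_onto_image {v \<in> tangent_space M A. norm v < R'} (riem_exp M A)"
    using AM r2 by (rule less_inj_radiusE)
  have "geo A v0 1 = h 0" "norm v0 + K < R'"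
    using v0 h(1,4) g(1) w(2) R'(1) by auto
  from norm_log_le_path_length[OF AM R'(2) h(2,3,6) v0(1) this]
  obtain v where v: "v \<in> tangents A" "norm v \<le> norm v0 + K" "geo A v 1 = B"
    using h(5) by auto
  have "ereal (norm v) < ereal (2 * r)"
    using v(2) v0(2) w(2) g(1) h(1) by simp
  then have "ereal (norm v) < inj_radius M"
    using r2 by (rule less_trans)
  then show ?thesis
    using v(1,3) by blast
qed

theorem riem_dist_geom_mean:
  assumes Z: "Z \<in> M" and r: "ereal r < rho M" and ABC: "{A, B, C} \<subseteq> riem_ball M Z r"
  shows "riem_dist M (geom_mean M A B) (geom_mean M A C) \<ge> riem_dist M B C / 2"
proof -
  have A: "A \<in> M"
    using ABC by (simp add: riem_ball_def)
  have half: "geom_mean M A X \<in> M \<and> double A (geom_mean M A X) = X" if X: "X \<in> riem_ball M Z r" for X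
  proof -
    obtain v where v: "v \<in> tangents A" "ereal (norm v) < inj_radius M" "geo A v 1 = X"
      using exists_log_in_ball[OF Z r _ X] ABC by blast
    then show ?thesis
      using geom_mean_eq_geo[OF A v(1,2)] double_geo[OF A v(1)] geo_mem[OF A v(1)] by simp
  qed
  then show ?thesis
    using riem_dist_double[OF A, of "geom_mean M A B" "geom_mean M A C"] ABC by simp
qed

end

subsection \<open>Matrices over the real and complex numbers\<close>

text \<open>Instantiated with the identity on the reals and with \<open>cnj\<close>. Pairing with 1
  is the real part, so \<open>inner_cj\<close> says that the Euclidean inner product is the real
  part of the Hermitian one.\<close>

locale conjugation =
  fixes cj :: "'a::{real_normed_field,euclidean_space} \<Rightarrow> 'a"
  assumes cj_add: "cj (x + y) = cj x + cj y"
    and cj_mult: "cj (x * y) = cj x * cj y"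
    and cj_cj [simp]: "cj (cj x) = x"
    and cj_scaleR: "cj (c *\<^sub>R x) = c *\<^sub>R cj x"
    and inner_cj: "inner x y = inner 1 (cj x * y)"
    and mult_cj: "x * cj x = of_real ((norm x)\<^sup>2)"
begin

lemma linear_cj: "linear cj"
  by (intro linearI cj_add cj_scaleR)

lemma cj_0 [simp]: "cj 0 = 0"
  by (rule linear_0[OF linear_cj])

lemma cj_sum: "cj (sum f I) = (\<Sum>i\<in>I. cj (f i))"
  by (rule linear_sum[OF linear_cj])

lemma inner_mult_left_cj: "inner (x * y) z = inner y (cj x * z)"
  by (simp add: inner_cj[of "x * y"] inner_cj[of y] cj_mult mult_ac)

lemma inner_mult_right_cj: "inner (x * y) z = inner x (z * cj y)"
  using inner_mult_left_cj[of y x z] by (simp add: mult.commute)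

text \<open>Turns real orthogonality into Hermitian orthogonality: the multiplier
  \<open>cj x\<close> produces the squared norm of \<open>x\<close>.\<close>

lemma eq_0_if_inner_mult_0:
  fixes x :: 'a
  assumes "\<And>a. inner 1 (a * x) = 0"
  shows "x = 0"
  using assms[of "cj x"] by (simp flip: inner_cj)

definition adjoint :: "'a^'n^'m \<Rightarrow> 'a^'m^'n" where
  "adjoint X = (\<chi> i j. cj (X $ j $ i))"

lemma bounded_bilinear_matrix_mult: "bounded_bilinear ((**) :: 'a^'n^'m \<Rightarrow> 'a^'p^'n \<Rightarrow> 'a^'p^'m)"
  unfolding bilinear_conv_bounded_bilinear[symmetric] bilinear_def
  by (intro conjI allI linearI)
    (simp_all add: matrix_add_ldistrib vec_eq_iff matrix_matrix_mult_def sum.distrib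
      algebra_simps scaleR_sum_right)

lemma star_algebra_matrix: "star_algebra ((**) :: 'a^'n^'n \<Rightarrow> 'a^'n^'n \<Rightarrow> 'a^'n^'n) (mat 1) adjoint"
proof
  fix X Y Z :: "'a^'n^'n"
  interpret mm: bounded_bilinear "(**) :: 'a^'n^'n \<Rightarrow> 'a^'n^'n \<Rightarrow> 'a^'n^'n"
    by (rule bounded_bilinear_matrix_mult)
  show "(X + Y) ** Z = X ** Z + Y ** Z" "X ** (Y + Z) = X ** Y + X ** Z"
    "(c *\<^sub>R X) ** Y = c *\<^sub>R (X ** Y)" "X ** (c *\<^sub>R Y) = c *\<^sub>R (X ** Y)" for c
    by (rule mm.add_left mm.add_right mm.scaleR_left mm.scaleR_right)+
  show "\<exists>K. \<forall>(X :: 'a^'n^'n) (Y :: 'a^'n^'n). norm (X ** Y) \<le> norm X * norm Y * K"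
    by (rule mm.bounded)
  show "X ** Y ** Z = X ** (Y ** Z)"
    by (simp add: matrix_mul_assoc)
  have "linear (adjoint :: 'a^'n^'n \<Rightarrow> 'a^'n^'n)"
    by (intro linearI) (simp_all add: adjoint_def vec_eq_iff cj_add cj_scaleR)
  then have "bounded_linear (adjoint :: 'a^'n^'n \<Rightarrow> 'a^'n^'n)"
    by (simp add: linear_conv_bounded_linear)
  then interpret adjoint: bounded_linear "adjoint :: 'a^'n^'n \<Rightarrow> 'a^'n^'n" .
  show "adjoint (X + Y) = adjoint X + adjoint Y" "adjoint (c *\<^sub>R X) = c *\<^sub>R adjoint X" for c
    by (rule adjoint.add adjoint.scaleR)+
  show "\<exists>K. \<forall>X :: 'a^'n^'n. norm (adjoint X) \<le> norm X * K"
    by (rule adjoint.bounded)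
  show "adjoint (X ** Y) = adjoint Y ** adjoint X"
    by (simp add: adjoint_def matrix_matrix_mult_def vec_eq_iff cj_sum cj_mult mult.commute)
  show "adjoint (adjoint X) = X"
    by (simp add: adjoint_def vec_eq_iff)
  have "inner (X ** Y) Z = (\<Sum>i\<in>UNIV. \<Sum>j\<in>UNIV. \<Sum>k\<in>UNIV. inner (Y $ k $ j) (cj (X $ i $ k) * Z $ i $ j))"
    by (simp add: inner_vec_def matrix_matrix_mult_def inner_sum_left inner_mult_left_cj)
  also have "\<dots> = (\<Sum>i\<in>UNIV. \<Sum>k\<in>UNIV. \<Sum>j\<in>UNIV. inner (Y $ k $ j) (cj (X $ i $ k) * Z $ i $ j))"
    by (intro sum.cong HOL.refl sum.swap)
  also have "\<dots> = (\<Sum>k\<in>UNIV. \<Sum>i\<in>UNIV. \<Sum>j\<in>UNIV. inner (Y $ k $ j) (cj (X $ i $ k) * Z $ i $ j))"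
    by (rule sum.swap)
  also have "\<dots> = (\<Sum>k\<in>UNIV. \<Sum>j\<in>UNIV. \<Sum>i\<in>UNIV. inner (Y $ k $ j) (cj (X $ i $ k) * Z $ i $ j))"
    by (intro sum.cong HOL.refl sum.swap)
  also have "\<dots> = inner Y (adjoint X ** Z)"
    by (simp add: inner_vec_def matrix_matrix_mult_def inner_sum_right adjoint_def)
  finally show "inner (X ** Y) Z = inner Y (adjoint X ** Z)" .
  have "inner (X ** Y) Z = (\<Sum>i\<in>UNIV. \<Sum>j\<in>UNIV. \<Sum>k\<in>UNIV. inner (X $ i $ k) (Z $ i $ j * cj (Y $ k $ j)))"
    by (simp add: inner_vec_def matrix_matrix_mult_def inner_sum_left inner_mult_right_cj)
  also have "\<dots> = (\<Sum>i\<in>UNIV. \<Sum>k\<in>UNIV. \<Sum>j\<in>UNIV. inner (X $ i $ k) (Z $ i $ j * cj (Y $ k $ j)))"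
    by (intro sum.cong HOL.refl sum.swap)
  also have "\<dots> = inner X (Z ** adjoint Y)"
    by (simp add: inner_vec_def matrix_matrix_mult_def inner_sum_right adjoint_def)
  finally show "inner (X ** Y) Z = inner X (Z ** adjoint Y)" .
qed simp_all

section \<open>Hermitian form, rank-one matrices and row spaces\<close>

definition herm :: "'a^'n \<Rightarrow> 'a^'n \<Rightarrow> 'a" where
  "herm x y = (\<Sum>i\<in>UNIV. x $ i * cj (y $ i))"

text \<open>Arranged for row vectors acted on from the right: \<open>outer y z\<close> sends
  \<open>x\<close> to a multiple of \<open>z\<close>, with coefficient \<open>herm x y\<close>; see
  \<open>vector_mult_outer\<close>.\<close>

definition outer :: "'a^'n \<Rightarrow> 'a^'n \<Rightarrow> 'a^'n^'n" where
  "outer x y = (\<chi> i j. cj (x $ i) * y $ j)"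

lemma herm_swap: "cj (herm x y) = herm y x"
  by (simp add: herm_def cj_sum cj_mult mult.commute)

lemma inner_eq_herm: "inner x y = inner 1 (herm y x)"
  unfolding inner_vec_def herm_def inner_sum_right
  by (intro sum.cong HOL.refl) (subst inner_cj, simp add: mult.commute)

lemma herm_scale_left: "herm (a *s x) y = a * herm x y"
  by (simp add: herm_def sum_distrib_left mult.assoc)

lemma herm_scaleR_right: "herm x (c *\<^sub>R y) = c *\<^sub>R herm x y"
  by (simp add: herm_def cj_scaleR scaleR_sum_right)

lemma herm_eq_0_swap: "herm x y = 0 \<Longrightarrow> herm y x = 0"
  by (metis cj_0 herm_swap)

lemma herm_mult_left: "herm (x v* A) y = herm x (y v* adjoint A)"
proof -
  have "herm (x v* A) y = (\<Sum>j\<in>UNIV. \<Sum>i\<in>UNIV. x $ i * A $ i $ j * cj (y $ j))"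
    by (simp add: herm_def vector_matrix_mult_def sum_distrib_left mult_ac)
  also have "\<dots> = (\<Sum>i\<in>UNIV. \<Sum>j\<in>UNIV. x $ i * A $ i $ j * cj (y $ j))"
    by (rule sum.swap)
  also have "\<dots> = herm x (y v* adjoint A)"
    by (simp add: herm_def vector_matrix_mult_def adjoint_def cj_sum cj_mult sum_distrib_left mult_ac)
  finally show ?thesis .
qed

lemma vector_mult_outer: "x v* outer y z = herm x y *s z"
  by (simp add: vec_eq_iff vector_matrix_mult_def outer_def herm_def sum_distrib_left mult_ac)

lemma outer_mult: "outer u z ** outer w y = (\<chi> i j. herm z w * outer u y $ i $ j)"
  by (simp add: vec_eq_iff matrix_matrix_mult_def outer_def herm_def sum_distrib_left mult_ac)

lemma adjoint_outer: "adjoint (outer u z) = outer z u"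
  by (simp add: adjoint_def outer_def vec_eq_iff cj_mult mult.commute)


text \<open>Projections are handled through their row spaces, because \<^const>\<open>rank\<close> is defined by rows.\<close>

definition row_fix :: "'a^'n^'n \<Rightarrow> ('a^'n) set" where
  "row_fix P = {y. y v* P = y}"

definition Gr :: "nat \<Rightarrow> ('a^'n^'n) set" where
  "Gr k = {P. P ** P = P \<and> adjoint P = P \<and> rank P = k}"

lemma linear_vector_matrix: "Vector_Spaces.linear (*s) (*s) (\<lambda>x :: 'a^'n. x v* A)"
proof -
  have "(\<lambda>x :: 'a^'n. x v* A) = (*v) (transpose A)"
    by (simp add: fun_eq_iff transpose_matrix_vector)
  then show ?thesis
    by (simp only: matrix_vector_mul_linear_gen)
qed

lemma vector_matrix_zero: "0 v* (A :: 'a^'m^'n) = 0"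
  by (simp add: vec_eq_iff vector_matrix_mult_def)

lemma vector_matrix_scaleR: "(c *\<^sub>R x) v* A = c *\<^sub>R (x v* (A :: 'a^'m^'n))"
  by (simp add: vec_eq_iff vector_matrix_mult_def scaleR_sum_right)

lemma vector_matrix_add: "(x + y) v* A = x v* A + y v* (A :: 'a^'m^'n)"
  by (simp add: vec_eq_iff vector_matrix_mult_def sum.distrib algebra_simps)

lemma vector_matrix_diff: "(x - y) v* A = x v* A - y v* (A :: 'a^'m^'n)"
  by (simp add: vec_eq_iff vector_matrix_mult_def sum_subtractf algebra_simps)

lemma vector_matrix_add_right: "x v* (A + B) = x v* A + x v* (B :: 'a^'m^'n)"
  by (simp add: vec_eq_iff vector_matrix_mult_def sum.distrib algebra_simps)

lemma vector_matrix_diff_right: "x v* (A - B) = x v* A - x v* (B :: 'a^'m^'n)"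
  by (simp add: vec_eq_iff vector_matrix_mult_def sum_subtractf algebra_simps)

lemma vector_matrix_scaleR_right: "x v* (c *\<^sub>R A) = c *\<^sub>R (x v* (A :: 'a^'m^'n))"
  by (simp add: vec_eq_iff vector_matrix_mult_def scaleR_sum_right)

lemma subspace_row_fix: "subspace (row_fix P)"
  by (simp add: subspace_def row_fix_def vector_matrix_add vector_matrix_scaleR vector_matrix_zero)

lemma vec_subspace_row_fix: "vec.subspace (row_fix (P :: 'a^'n^'n))"
proof -
  interpret l: Vector_Spaces.linear "(*s)" "(*s)" "\<lambda>x :: 'a^'n. x v* P"
    by (rule linear_vector_matrix)
  show ?thesis
    by (simp add: vec.subspace_def row_fix_def l.add l.scale l.zero)
qed

lemma row_eq_axis_mult: "row i A = axis i 1 v* A"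
  by (simp add: vec_eq_iff row_def vector_matrix_mult_def axis_def if_distrib if_distribR cong: if_cong)

lemma vector_matrix_mult_in_span_rows: "y v* A \<in> vec.span (rows A)"
proof -
  have "y v* A = (\<Sum>i\<in>UNIV. y $ i *s row i A)"
    by (simp add: vec_eq_iff vector_matrix_mult_def row_def mult.commute)
  also have "\<dots> \<in> vec.span (rows A)"
    by (intro vec.span_sum vec.span_scale vec.span_base) (auto simp: rows_def)
  finally show ?thesis .
qed

text \<open>For an idempotent the row space is exactly the set of fixed row vectors.\<close>

lemma rank_eq_dim_row_fix:
  assumes "P ** P = P"
  shows "rank P = vec.dim (row_fix P)"
proof -
  have "rows P \<subseteq> row_fix P"
    by (auto simp: rows_def row_fix_def row_eq_axis_mult vector_matrix_mul_assoc assms)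
  moreover have "row_fix P \<subseteq> vec.span (rows P)"
    using vector_matrix_mult_in_span_rows[of _ P] by (auto simp: row_fix_def) metis
  ultimately have "vec.span (rows P) = row_fix P"
    using vec_subspace_row_fix by (metis subset_antisym vec.span_minimal)
  then show ?thesis
    by (metis row_rank_def_gen vec.dim_span)
qed

text \<open>Equal row spaces give P Q = P and Q P = Q; the adjoint of the first equation is Q P =
  P.\<close>

lemma eq_if_row_fix_eq:
  fixes P Q :: "'a^'n^'n"
  assumes P: "P ** P = P" "adjoint P = P" and Q: "Q ** Q = Q" "adjoint Q = Q"
    and eq: "row_fix P = row_fix Q"
  shows "P = Q"
proof -
  interpret star_algebra "(**) :: 'a^'n^'n \<Rightarrow> _" "mat 1" adjoint
    by (rule star_algebra_matrix)
  have absorb: "P ** Q = P" if "row_fix P \<subseteq> row_fix Q" "P ** P = P" for P Q :: "'a^'n^'n"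
  proof -
    have "row i (P ** Q) = row i P" for i
    proof -
      have "row i P \<in> row_fix P"
        by (simp add: row_fix_def row_eq_axis_mult vector_matrix_mul_assoc that(2))
      then have "row i P \<in> row_fix Q"
        using that(1) by blast
      then show ?thesis
        by (simp add: row_fix_def row_eq_axis_mult flip: vector_matrix_mul_assoc)
    qed
    then show ?thesis
      by (metis row_def vec_lambda_eta vec_eq_iff)
  qed
  have "P ** Q = P"
    by (rule absorb) (simp_all add: eq P)
  moreover have "Q ** P = Q"
    by (rule absorb) (simp_all add: eq Q)
  ultimately show ?thesis
    using P(2) Q(2) adj_mul[of P Q] by simp
qed

text \<open>Right multiplication by \<open>U'\<close> carries the fixed rows of \<open>P\<close>
  over those of the conjugate, so the rank cannot grow. The opposite inequality is the same fact for
  the inverse conjugation.\<close>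

lemma rank_conj:
  fixes U U' P :: "'a^'n^'n"
  assumes U: "U ** U' = mat 1" "U' ** U = mat 1" and P: "P ** P = P"
  shows "rank (U ** P ** U') = rank P"
proof -
  have le: "rank (U ** P ** U') \<le> rank P" if "U' ** U = mat 1" "P ** P = P" for U U' P :: "'a^'n^'n"
  proof -
    have "(U ** P ** U') ** (U ** P ** U') = U ** (P ** (U' ** U) ** P) ** U'"
      by (simp only: matrix_mul_assoc)
    then have idem: "(U ** P ** U') ** (U ** P ** U') = U ** P ** U'"
      using that by simp
    have "row_fix (U ** P ** U') \<subseteq> (\<lambda>x. x v* U') ` row_fix P"
    proof
      fix y
      assume "y \<in> row_fix (U ** P ** U')"
      then have "y = (y v* (U ** P)) v* U'"
        by (simp add: row_fix_def vector_matrix_mul_assoc)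
      moreover have "y v* (U ** P) \<in> row_fix P"
        by (simp add: row_fix_def vector_matrix_mul_assoc that(2) flip: matrix_mul_assoc)
      ultimately show "y \<in> (\<lambda>x. x v* U') ` row_fix P"
        by blast
    qed
    then have "vec.dim (row_fix (U ** P ** U')) \<le> vec.dim ((\<lambda>x. x v* U') ` row_fix P)"
      by (rule vec.dim_subset)
    also have "\<dots> \<le> vec.dim (row_fix P)"
      using linear_vector_matrix by (rule vec.dim_image_le)
    finally show ?thesis
      by (simp add: rank_eq_dim_row_fix idem that(2))
  qed
  let ?Q = "U ** P ** U'"
  have "?Q ** ?Q = U ** (P ** (U' ** U) ** P) ** U'"
    by (simp only: matrix_mul_assoc)
  then have "?Q ** ?Q = ?Q"
    using U P by simp
  then have "rank (U' ** ?Q ** U) \<le> rank ?Q"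
    by (rule le[OF U(1)])
  moreover have "U' ** ?Q ** U = (U' ** U) ** P ** (U' ** U)"
    by (simp only: matrix_mul_assoc)
  ultimately show ?thesis
    using le[OF U(2) P] U by simp
qed

lemma herm_self: "herm u u = of_real ((norm u)\<^sup>2)"
  by (simp add: herm_def mult_cj norm_vec_def L2_set_def sum_nonneg)

lemma outer_mult_1: "herm z w = 1 \<Longrightarrow> outer u z ** outer w y = outer u y"
  by (simp add: outer_mult vec_eq_iff)

lemma outer_mult_0: "herm z w = 0 \<Longrightarrow> outer u z ** outer w y = 0"
  by (simp add: outer_mult vec_eq_iff)

section \<open>Connecting projections of equal rank\<close>

abbreviation connected_by_conj :: "'a^'n^'n \<Rightarrow> 'a^'n^'n \<Rightarrow> bool" where
  "connected_by_conj \<equiv> star_algebra.conj_connected (**) (mat 1) adjoint"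

text \<open>The flow of \<open>c\<close> is the rotation in the plane spanned by \<open>u\<close>
  and \<open>z\<close>, and \<open>p\<close> is the projection onto that plane. Rows orthogonal to
  both vectors stay fixed.\<close>

lemma rotate_projection:
  fixes P :: "'a^'n^'n"
  assumes P: "P \<in> Gr k" and u: "u \<in> row_fix P" "norm u = 1" and z: "z v* P = 0" "norm z = 1"
  shows "\<exists>P'\<in>Gr k. connected_by_conj P P' \<and> cos \<theta> *\<^sub>R u + sin \<theta> *\<^sub>R z \<in> row_fix P' \<and>
    (\<forall>y\<in>row_fix P. herm y u = 0 \<longrightarrow> y \<in> row_fix P')"
proof -
  interpret S: star_algebra "(**) :: 'a^'n^'n \<Rightarrow> _" "mat 1" adjoint
    by (rule star_algebra_matrix)
  have idem: "P ** P = P" and adj: "adjoint P = P" and rank: "rank P = k"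
    using P by (simp_all add: Gr_def)
  have orth: "herm y z = 0" if "y \<in> row_fix P" for y
  proof -
    have "herm y z = herm (y v* P) z"
      using that by (simp add: row_fix_def)
    also have "\<dots> = herm y 0"
      by (simp add: herm_mult_left adj z(1))
    finally show ?thesis
      by (simp add: herm_def)
  qed
  have uz: "herm u z = 0" "herm z u = 0" and uu: "herm u u = 1" "herm z z = 1"
    using orth[OF u(1)] herm_eq_0_swap u(2) z(2) by (auto simp: herm_self)
  define c where "c = outer u z - outer z u"
  define p where "p = outer u u + outer z z"
  have cc: "c ** c = - p" and pc: "p ** c = c"
    by (simp_all add: c_def p_def S.mul.diff_left S.mul.diff_right S.mul.add_left
        outer_mult_0 outer_mult_1 uz uu)
  have skew: "S.skew c"
    by (simp add: S.skew_def c_def S.adj.diff adjoint_outer)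
  \<comment> \<open>The relations \<open>cc\<close> and \<open>pc\<close> make the closed form solve
    the equation that characterises the flow.\<close>
  have flow: "S.flow c t = mat 1 + (cos t - 1) *\<^sub>R p + sin t *\<^sub>R c" for t
  proof (rule S.skew_ode_unique[OF skew S.flow_has_vector_derivative])
    fix t
    have "((\<lambda>t. mat 1 + (cos t - 1) *\<^sub>R p + sin t *\<^sub>R c) has_vector_derivative (- sin t) *\<^sub>R p + cos t *\<^sub>R c) (at t)"
      by (auto intro!: derivative_eq_intros simp: has_real_derivative_iff_has_vector_derivative[symmetric])
    moreover have "(mat 1 + (cos t - 1) *\<^sub>R p + sin t *\<^sub>R c) ** c = (- sin t) *\<^sub>R p + cos t *\<^sub>R c"
      by (simp add: S.mul.add_left S.mul.diff_left S.mul.scaleR_left cc pc algebra_simps)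
    ultimately show "((\<lambda>t. mat 1 + (cos t - 1) *\<^sub>R p + sin t *\<^sub>R c) has_vector_derivative
        (mat 1 + (cos t - 1) *\<^sub>R p + sin t *\<^sub>R c) ** c) (at t)"
      by simp
  qed simp
  note vm = vector_matrix_add_right vector_matrix_diff_right vector_matrix_scaleR_right vector_mult_outer
  have flow_u: "u v* S.flow c t = cos t *\<^sub>R u + sin t *\<^sub>R z" for t
    unfolding flow unfolding c_def p_def by (simp add: vm uz uu algebra_simps)
  have flow_y: "y v* S.flow c t = y" if "herm y u = 0" "herm y z = 0" for y t
    using that unfolding flow unfolding c_def p_def by (simp add: vm)
  \<comment> \<open>The sign is negative because the rows of the conjugated projection are moved by
    \<open>adjoint V\<close>, which is then the rotation by \<theta>.\<close>
  define V where "V = S.flow c (- \<theta>)"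
  define P' where "P' = V ** P ** adjoint V"
  have adjV: "adjoint V = S.flow c \<theta>"
    by (simp add: V_def S.adj_flow skew)
  have unitary: "V ** adjoint V = mat 1" "adjoint V ** V = mat 1"
    using S.unitary_flow[OF skew, of "- \<theta>"] by (simp_all add: S.unitary_def V_def)
  have skew': "S.skew ((- \<theta>) *\<^sub>R c)"
    using skew by (simp add: S.skew_def S.adj.scaleR S.adj.neg)
  have "S.flow ((- \<theta>) *\<^sub>R c) 1 = V"
    unfolding V_def S.flow_scaleR[OF skew] by simp
  then have "connected_by_conj P P'"
    using S.conj_connected_flow[OF skew', of P] by (simp only: P'_def)
  moreover have "P' \<in> Gr k"
  proof -
    have "P' ** P' = V ** (P ** (adjoint V ** V) ** P) ** adjoint V"
      by (simp only: P'_def matrix_mul_assoc)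
    then have "P' ** P' = P'"
      by (simp add: unitary idem P'_def)
    moreover have "adjoint P' = P'"
      by (simp add: P'_def S.adj_mul adj matrix_mul_assoc)
    moreover have "rank P' = k"
      unfolding P'_def rank[symmetric] by (rule rank_conj[OF unitary idem])
    ultimately show ?thesis
      by (simp add: Gr_def)
  qed
  moreover have "cos \<theta> *\<^sub>R u + sin \<theta> *\<^sub>R z \<in> row_fix P'"
  proof -
    let ?w = "cos \<theta> *\<^sub>R u + sin \<theta> *\<^sub>R z"
    have "?w = u v* adjoint V"
      by (simp add: adjV flow_u)
    then have "?w v* V = u"
      by (simp add: vector_matrix_mul_assoc unitary)
    then have "?w v* P' = (u v* P) v* adjoint V"
      by (simp add: P'_def flip: vector_matrix_mul_assoc)
    also have "\<dots> = ?w"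
      using u(1) by (simp add: row_fix_def adjV flow_u)
    finally show ?thesis
      by (simp add: row_fix_def)
  qed
  moreover have "y \<in> row_fix P'" if y: "y \<in> row_fix P" "herm y u = 0" for y
  proof -
    have "y v* V = y" "y v* adjoint V = y"
      using flow_y[OF y(2) orth[OF y(1)]] unfolding adjV unfolding V_def by simp_all
    then show ?thesis
      using y(1) by (simp add: row_fix_def P'_def flip: vector_matrix_mul_assoc)
  qed
  ultimately show ?thesis
    by blast
qed

text \<open>\<open>W\<close> is closed under multiplication by all scalars of the field, so real
  orthogonality can be tested against every multiple of \<open>y\<close>.\<close>

lemma herm_eq_0_if_orthogonal:
  assumes "vec.subspace W" "\<And>y. y \<in> W \<Longrightarrow> orthogonal x y" "y \<in> W"
  shows "herm y x = 0"
proof (rule eq_0_if_inner_mult_0)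
  fix a
  have "orthogonal x (a *s y)"
    using assms by (simp add: vec.subspace_scale)
  then show "inner 1 (a * herm y x) = 0"
    by (simp add: orthogonal_def inner_eq_herm[of x] herm_scale_left)
qed

lemma exists_unit_orthogonal:
  assumes W: "vec.subspace W" "subspace W" and T: "subspace T" "W \<subset> T"
  shows "\<exists>x\<in>T. norm x = 1 \<and> (\<forall>y\<in>W. herm y x = 0)"
proof -
  have "span W \<subset> span T"
    using W(2) T by (simp add: span_eq_iff[THEN iffD2])
  then obtain x where x: "x \<noteq> 0" "x \<in> span T" "\<And>y. y \<in> span W \<Longrightarrow> orthogonal x y"
    using orthogonal_to_subspace_exists_gen[of W T] by metis
  let ?x = "(1 / norm x) *\<^sub>R x"
  have "?x \<in> T"
    using x(2) T(1) by (simp add: span_eq_iff[THEN iffD2] subspace_scale)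
  moreover have "norm ?x = 1"
    using x(1) by simp
  moreover have "herm y ?x = 0" if "y \<in> W" for y
    using herm_eq_0_if_orthogonal[OF W(1) x(3)[OF span_base] that] by (simp add: herm_scaleR_right)
  ultimately show ?thesis
    by blast
qed

text \<open>\<open>P\<close> is rotated until its row space contains a unit vector of the row space of \<open>Q\<close> orthogonal to
  the intersection of the two; the intersection itself stays fixed.\<close>

lemma enlarge_intersection:
  fixes P Q :: "'a^'n^'n"
  assumes P: "P \<in> Gr k" and Q: "Q \<in> Gr k" and ne: "P \<noteq> Q"
  shows "\<exists>P'\<in>Gr k. connected_by_conj P P' \<and> row_fix P \<inter> row_fix Q \<subset> row_fix P' \<inter> row_fix Q"
proof -
  have P': "P ** P = P" "adjoint P = P" and Q': "Q ** Q = Q" "adjoint Q = Q"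
    and rank: "rank P = k" "rank Q = k"
    using P Q by (simp_all add: Gr_def)
  let ?W = "row_fix P \<inter> row_fix Q"
  have W: "vec.subspace ?W" "subspace ?W"
    by (simp_all add: vec.subspace_inter subspace_inter vec_subspace_row_fix subspace_row_fix)
  have dims: "vec.dim (row_fix P) = vec.dim (row_fix Q)"
    using rank by (simp add: rank_eq_dim_row_fix P' Q')
  have "row_fix P \<noteq> row_fix Q"
    using eq_if_row_fix_eq[OF P' Q'] ne by blast
  \<comment> \<open>Distinct row spaces of equal dimension cannot be nested, so both contain a unit
    vector orthogonal to the intersection.\<close>
  then have "\<not> row_fix P \<subseteq> row_fix Q" "\<not> row_fix Q \<subseteq> row_fix P"
    using vec.subspace_dim_equal[OF vec_subspace_row_fix vec_subspace_row_fix] dims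
    by (metis order.refl)+
  then have sub: "?W \<subset> row_fix P" "?W \<subset> row_fix Q"
    by blast+
  obtain v where v: "v \<in> row_fix P" "norm v = 1" "\<forall>y\<in>?W. herm y v = 0"
    using exists_unit_orthogonal[OF W subspace_row_fix sub(1)] by blast
  obtain w where w: "w \<in> row_fix Q" "norm w = 1" "\<forall>y\<in>?W. herm y w = 0"
    using exists_unit_orthogonal[OF W subspace_row_fix sub(2)] by blast
  have w_notin: "w \<notin> row_fix P"
  proof
    assume "w \<in> row_fix P"
    then have "herm w w = 0"
      using w by blast
    then show False
      using w(2) by (simp add: herm_self)
  qed
  define w1 where "w1 = w v* P"
  define w2 where "w2 = w - w1"
  have w1: "w1 \<in> row_fix P" and w2: "w2 v* P = 0"
    by (simp_all add: row_fix_def w1_def w2_def vector_matrix_diff vector_matrix_mul_assoc P')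
  have w2_ne: "w2 \<noteq> 0"
    using w_notin w1 by (auto simp: w2_def)
  have "\<exists>u z \<theta>. u \<in> row_fix P \<and> norm u = 1 \<and> (\<forall>y\<in>?W. herm y u = 0) \<and> z v* P = 0 \<and> norm z = 1 \<and>
      w = cos \<theta> *\<^sub>R u + sin \<theta> *\<^sub>R z"
  proof (cases "w1 = 0")
    \<comment> \<open>Here \<open>w\<close> is orthogonal to the row space of \<open>P\<close>, so
      its projection gives no direction to rotate from; the vector \<open>v\<close> serves instead,
      with a quarter turn.\<close>
    case True
    then show ?thesis
      using v w(2) w2 by (intro exI[of _ v] exI[of _ w] exI[of _ "pi/2"]) (simp add: w2_def)
  next
    case False
    have "herm w1 w2 = herm w (w2 v* adjoint P)"
      unfolding w1_def by (rule herm_mult_left)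
    then have "herm w1 w2 = 0"
      by (simp add: P' w2) (simp add: herm_def)
    then have "inner w2 w1 = 0"
      by (simp add: inner_eq_herm)
    then have "orthogonal w1 w2"
      by (simp add: orthogonal_def inner_commute)
    then have "(norm w1)\<^sup>2 + (norm w2)\<^sup>2 = (norm w)\<^sup>2"
      using norm_add_Pythagorean[of w1 w2] by (simp add: w2_def)
    then obtain \<theta> where \<theta>: "norm w1 = cos \<theta>" "norm w2 = sin \<theta>"
      using sincos_total_2pi[of "norm w1" "norm w2"] w(2) by auto
    have "herm y w1 = 0" if "y \<in> ?W" for y
    proof -
      have "herm y w1 = herm (y v* P) w"
        by (simp add: w1_def herm_mult_left P')
      also have "\<dots> = herm y w"
        using that by (simp add: row_fix_def)
      finally show ?thesis
        using w(3) that by simp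
    qed
    moreover have "w = cos \<theta> *\<^sub>R ((1 / norm w1) *\<^sub>R w1) + sin \<theta> *\<^sub>R ((1 / norm w2) *\<^sub>R w2)"
      using False w2_ne by (simp add: w2_def flip: \<theta>)
    moreover have "(1 / norm w1) *\<^sub>R w1 \<in> row_fix P"
      using subspace_row_fix w1 by (rule subspace_scale)
    moreover have "((1 / norm w2) *\<^sub>R w2) v* P = 0"
      by (simp add: vector_matrix_scaleR w2)
    ultimately show ?thesis
      using False w2_ne
      by (intro exI[of _ "(1 / norm w1) *\<^sub>R w1"] exI[of _ "(1 / norm w2) *\<^sub>R w2"] exI[of _ \<theta>])
        (simp add: herm_scaleR_right)
  qed
  then obtain u z \<theta> where u: "u \<in> row_fix P" "norm u = 1" "\<forall>y\<in>?W. herm y u = 0"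
    and z: "z v* P = 0" "norm z = 1" and w_eq: "w = cos \<theta> *\<^sub>R u + sin \<theta> *\<^sub>R z"
    by (elim exE conjE)
  from rotate_projection[OF P u(1,2) z, of \<theta>] obtain P1 where P1: "P1 \<in> Gr k" "connected_by_conj P P1"
    "w \<in> row_fix P1" "\<forall>y\<in>row_fix P. herm y u = 0 \<longrightarrow> y \<in> row_fix P1"
    unfolding w_eq by blast
  have "?W \<subseteq> row_fix P1 \<inter> row_fix Q"
    using P1(4) u(3) by blast
  moreover have "w \<in> row_fix P1 \<inter> row_fix Q" "w \<notin> ?W"
    using P1(3) w(1) w_notin by blast+
  ultimately have "?W \<subset> row_fix P1 \<inter> row_fix Q"
    by blast
  with P1(1,2) show ?thesis
    by blast
qed

text \<open>Induction on the real codimension of the intersection of the row spaces: each rotation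
  enlarges the intersection strictly until the projections coincide.\<close>

lemma Gr_connected:
  fixes P Q :: "'a^'n^'n"
  assumes "P \<in> Gr k" "Q \<in> Gr k"
  shows "connected_by_conj P Q"
  using assms
proof (induction "DIM('a^'n) - dim (row_fix P \<inter> row_fix Q)" arbitrary: P rule: less_induct)
  case less
  interpret S: star_algebra "(**) :: 'a^'n^'n \<Rightarrow> _" "mat 1" adjoint
    by (rule star_algebra_matrix)
  show ?case
  proof (cases "P = Q")
    case True
    then show ?thesis
      using S.conj_connected_refl by simp
  next
    case False
    then obtain P' where P': "P' \<in> Gr k" "connected_by_conj P P'"
      "row_fix P \<inter> row_fix Q \<subset> row_fix P' \<inter> row_fix Q"
      using enlarge_intersection[OF less.prems] by blast
    have "subspace (row_fix P \<inter> row_fix Q)" "subspace (row_fix P' \<inter> row_fix Q)"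
      by (simp_all add: subspace_inter subspace_row_fix)
    then have "span (row_fix P \<inter> row_fix Q) \<subset> span (row_fix P' \<inter> row_fix Q)"
      using P'(3) by (simp add: span_eq_iff[THEN iffD2])
    then have "dim (row_fix P \<inter> row_fix Q) < dim (row_fix P' \<inter> row_fix Q)"
      by (rule dim_psubset)
    moreover have "dim (row_fix P' \<inter> row_fix Q) \<le> DIM('a^'n)"
      by (rule dim_subset_UNIV)
    ultimately have "connected_by_conj P' Q"
      using less.hyps[of P'] P'(1) less.prems(2) by simp
    with P'(2) show ?thesis
      by (rule S.conj_connected_trans)
  qed
qed

lemma projection_manifold_Gr:
  "projection_manifold ((**) :: 'a^'n^'n \<Rightarrow> 'a^'n^'n \<Rightarrow> 'a^'n^'n) (mat 1) adjoint (Gr k)"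
proof -
  interpret S: star_algebra "(**) :: 'a^'n^'n \<Rightarrow> _" "mat 1" adjoint
    by (rule star_algebra_matrix)
  show ?thesis
  proof
    fix P Q :: "'a^'n^'n"
    assume P: "P \<in> Gr k"
    show "P ** P = P" "adjoint P = P"
      using P by (simp_all add: Gr_def)
    show "S.conj_connected P Q" if "Q \<in> Gr k"
      by (rule Gr_connected[OF P that])
    fix u
    assume "S.unitary u"
    then have u: "u ** adjoint u = mat 1" "adjoint u ** u = mat 1"
      by (simp_all add: S.unitary_def)
    have "(u ** P ** adjoint u) ** (u ** P ** adjoint u) = u ** (P ** (adjoint u ** u) ** P) ** adjoint u"
      by (simp only: matrix_mul_assoc)
    then have "(u ** P ** adjoint u) ** (u ** P ** adjoint u) = u ** P ** adjoint u"
      using P by (simp add: Gr_def u)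
    moreover have "adjoint (u ** P ** adjoint u) = u ** P ** adjoint u"
      using P by (simp add: Gr_def S.adj_mul matrix_mul_assoc)
    ultimately show "u ** P ** adjoint u \<in> Gr k"
      using P rank_conj[OF u, of P] by (simp add: Gr_def)
  qed
qed

end

section \<open>The real and the complex Grassmannian\<close>

lemma conjugation_real: "conjugation (\<lambda>x :: real. x)"
proof
  fix x y :: real
  show "inner x y = inner 1 (x * y)"
    by (simp only: inner_real_def mult_1)
  show "x * x = of_real ((norm x)\<^sup>2)"
    by (simp only: of_real_eq_id id_apply real_norm_def power2_abs power2_eq_square)
qed (rule HOL.refl)+

lemma conjugation_complex: "conjugation cnj"
proof
  fix x y :: complex
  show "inner x y = inner 1 (cnj x * y)"
    by (simp add: inner_complex_def)
  show "x * cnj x = of_real ((norm x)\<^sup>2)"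
    by (rule complex_norm_square[symmetric])
qed simp_all

lemma Gr_real_eq: "Gr_real k = conjugation.Gr (\<lambda>x. x) k"
  unfolding Gr_real_def conjugation.Gr_def[OF conjugation_real]
    conjugation.adjoint_def[OF conjugation_real] transpose_def by (rule HOL.refl)

lemma Gr_complex_eq: "Gr_complex k = conjugation.Gr cnj k"
  unfolding Gr_complex_def conjugation.Gr_def[OF conjugation_complex]
    conjugation.adjoint_def[OF conjugation_complex] conj_transpose_def map_matrix_def transpose_def
  by simp

theorem proposition2p7:
  fixes k :: nat
  shows "(\<forall>(Z::real^'n^'n) A B C r.
            Z \<in> Gr_real k \<and> ereal r < rho (Gr_real k :: (real^'n^'n) set) \<and>
            {A, B, C} \<subseteq> riem_ball (Gr_real k) Z r \<longrightarrow>
            riem_dist (Gr_real k) (geom_mean (Gr_real k) A B) (geom_mean (Gr_real k) A C)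
              \<ge> riem_dist (Gr_real k) B C / 2) \<and>
         (\<forall>(Z::complex^'n^'n) A B C r.
            Z \<in> Gr_complex k \<and> ereal r < rho (Gr_complex k :: (complex^'n^'n) set) \<and>
            {A, B, C} \<subseteq> riem_ball (Gr_complex k) Z r \<longrightarrow>
            riem_dist (Gr_complex k) (geom_mean (Gr_complex k) A B) (geom_mean (Gr_complex k) A C)
              \<ge> riem_dist (Gr_complex k) B C / 2)"
proof (intro conjI allI impI)
  fix Z A B C :: "real^'n^'n" and r
  interpret projection_manifold "(**)" "mat 1" "conjugation.adjoint (\<lambda>x :: real. x)" "Gr_real k :: (real^'n^'n) set"
    unfolding Gr_real_eq by (rule conjugation.projection_manifold_Gr[OF conjugation_real])
  assume "Z \<in> Gr_real k \<and> ereal r < rho (Gr_real k :: (real^'n^'n) set) \<and> {A, B, C} \<subseteq> riem_ball (Gr_real k) Z r"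
  then show "riem_dist (Gr_real k) (geom_mean (Gr_real k) A B) (geom_mean (Gr_real k) A C)
      \<ge> riem_dist (Gr_real k) B C / 2"
    by (elim conjE) (rule riem_dist_geom_mean)
next
  fix Z A B C :: "complex^'n^'n" and r
  interpret projection_manifold "(**)" "mat 1" "conjugation.adjoint cnj" "Gr_complex k :: (complex^'n^'n) set"
    unfolding Gr_complex_eq by (rule conjugation.projection_manifold_Gr[OF conjugation_complex])
  assume "Z \<in> Gr_complex k \<and> ereal r < rho (Gr_complex k :: (complex^'n^'n) set) \<and> {A, B, C} \<subseteq> riem_ball (Gr_complex k) Z r"
  then show "riem_dist (Gr_complex k) (geom_mean (Gr_complex k) A B) (geom_mean (Gr_complex k) A C)
      \<ge> riem_dist (Gr_complex k) B C / 2"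
    by (elim conjE) (rule riem_dist_geom_mean)
qed

end
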